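(* Let $r>0$, $s\ge0$ be constants, and suppose that, for each $n$, $\theta\in\mathbb{R}^p$, $\eta\in\mathbb{R}^q$ (with $\theta,\eta,p,q$ allowed to depend on $n$) satisfy $$\frac{2\|\theta\|\|\eta\|}{\sqrt{\|\theta\|^2+\|\eta\|^2}}=\sqrt{2r\log n},\qquad \frac{\big|\|\theta\|^2-\|\eta\|^2\big|}{\sqrt{\|\theta\|^2+\|\eta\|^2}}=\sqrt{2s\log n}.$$ Suppose $p\vee q<n^{1-\delta}$ for some constant $\delta\in(0,1)$. Then there exists a constant $\gamma>0$ depending on $\delta$ such that, for the spectral estimators $\widehat\theta(\cdot),\widehat\eta(\cdot)$ defined in the context, both of the following hold: (i) with the two-part random split, $\widehat\theta^{(m)}=\widehat\theta(\{X_i\}_{i\in\mathcal D_m})$ and $\widehat\eta^{(m)}=\widehat\eta(\{Y_i\}_{i\in\mathcal D_m})$, $m=0,1$, $$\lim_{n\to\infty}\sup_{z,\sigma\in\{-1,1\}^n}P^{(n)}_{(\theta,\eta,z,\sigma)}\left(L(\widehat\theta^{(0)},\theta)\vee L(\widehat\theta^{(1)},\theta)\vee L(\widehat\eta^{(0)},\eta)\vee L(\widehat\eta^{(1)},\eta)>n^{-\gamma}\right)=0;$$ (ii) with the three-part random split, $\widehat\theta=\widehat\theta(\{X_i\}_{i\in\mathcal D_0})$ and $\widehat\eta=\widehat\eta(\{Y_i\}_{i\in\mathcal D_0})$, $$\lim_{n\to\infty}\sup_{z,\sigma\in\{-1,1\}^n}P^{(n)}_{(\theta,\eta,z,\sigma)}\left(L(\widehat\theta,\theta)\vee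 L(\widehat\eta,\eta)>n^{-\gamma}\right)=0.$$
   Context: Model: for $z,\sigma\in\{-1,1\}^n$, $P^{(n)}_{(\theta,\eta,z,\sigma)}$ is the joint law of independent $X_i\sim N(z_i\theta,I_p)$, $Y_i\sim N(\sigma_i\eta,I_q)$, $i\in[n]$, together with the independent splitting variables. Write $a\vee b=\max(a,b)$, $a\wedge b=\min(a,b)$. Losses: $L(\widehat\theta,\theta)=\|\widehat\theta-\theta\|\wedge\|\widehat\theta+\theta\|$ and similarly for $\eta$. Splits: in the two-part split, $d_1,\dots,d_n$ are i.i.d. Bernoulli$(1/2)$ and $\mathcal D_m=\{i:d_i=m\}$, $m=0,1$; in the three-part split, $d_1,\dots,d_n$ are i.i.d. uniform on $\{0,1,2\}$ and $\mathcal D_m=\{i:d_i=m\}$, $m=0,1,2$; in both cases independent of the data. Spectral estimator: for a sample $\{X_i\}_{i\in\mathcal D}$, let $\widehat\lambda_1$ be the largest eigenvalue of $\frac1{|\mathcal D|}\sum_{i\in\mathcal D}X_iX_i^T$ and $\widehat u_1$ a corresponding unit eigenvector; then $\widehat\theta(\{X_i\}_{i\in\mathcal D})=\sqrt{\widehat\lambda_1-1}\,\widehat u_1$ (set to $0$ if $\mathcal D=\varnothing$ or $\widehat\lambda_1<1$). The estimator $\widehat\eta(\cdot)$ is the same construction applied to $\{Y_i\}_{i\in\mathcal D}$. *)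

theory Defs
  imports "HOL-Probability.Probability" "Jordan_Normal_Form.Char_Poly"
begin

(* Both libraries claim these symbols; here they denote the operations on Matrix.vec. *)
no_notation vec_nth (infixl "$" 90)
no_notation inner (infix "\<bullet>" 70)

definition l2_norm :: "real Matrix.vec \<Rightarrow> real" where
  "l2_norm v = sqrt (v \<bullet> v)"

definition sign_loss :: "real Matrix.vec \<Rightarrow> real Matrix.vec \<Rightarrow> real" where
  "sign_loss t v = min (l2_norm (t - v)) (l2_norm (t + v))"

(* A sample is a family x of vectors of dimension p, of which the members x i with i in D
   are used. *)
definition second_moment_mat ::
    "nat \<Rightarrow> nat set \<Rightarrow> (nat \<Rightarrow> real Matrix.vec) \<Rightarrow> real Matrix.mat" where
  "second_moment_mat p D x =
     Matrix.mat p p (\<lambda>(j, k). (1 / real (card D)) * (\<Sum>i\<in>D. x i $ j * x i $ k))"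

definition top_eigenvalue :: "real Matrix.mat \<Rightarrow> real" where
  "top_eigenvalue A = Max {k. eigenvalue A k}"

(* The leading unit eigenvector is determined only up to sign, and not even that when the top
   eigenvalue is multiple.  The predicate admits every rule est for choosing it. *)
definition spectral_estimator ::
    "nat \<Rightarrow> (nat set \<Rightarrow> (nat \<Rightarrow> real Matrix.vec) \<Rightarrow> real Matrix.vec) \<Rightarrow> bool" where
  "spectral_estimator p est \<longleftrightarrow>
     (\<forall>D x. finite D \<longrightarrow> (\<forall>i\<in>D. x i \<in> carrier_vec p) \<longrightarrow>
        (let S = second_moment_mat p D x; l = top_eigenvalue S in
         if D = {} \<or> l < 1 then est D x = 0\<^sub>v p
         else \<exists>u. eigenvector S u l \<and> l2_norm u = 1 \<and> est D x = sqrt (l - 1) \<cdot>\<^sub>v u))"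

(* N(v, I_p), on coordinate functions {..<p} -> real. *)
definition gauss_vec :: "nat \<Rightarrow> real Matrix.vec \<Rightarrow> (nat \<Rightarrow> real) measure" where
  "gauss_vec p v = (\<Pi>\<^sub>M j\<in>{..<p}. density lborel (normal_density (v $ j) 1))"

definition sign_vectors :: "nat \<Rightarrow> (nat \<Rightarrow> real) set" where
  "sign_vectors n = {..<n} \<rightarrow>\<^sub>E {-1, 1}"

(* Joint law of (X, Y, d).  The splitting variables d i are i.i.d. uniform on {..<k}:
   k = 2 is Bernoulli(1/2), k = 3 is uniform on {0, 1, 2}. *)
definition model ::
    "nat \<Rightarrow> nat \<Rightarrow> nat \<Rightarrow> nat \<Rightarrow> real Matrix.vec \<Rightarrow> real Matrix.vec \<Rightarrow>
     (nat \<Rightarrow> real) \<Rightarrow> (nat \<Rightarrow> real) \<Rightarrow>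
     ((nat \<Rightarrow> nat \<Rightarrow> real) \<times> (nat \<Rightarrow> nat \<Rightarrow> real) \<times> (nat \<Rightarrow> nat)) measure" where
  "model k n p q \<theta> \<eta> z \<sigma> =
     (\<Pi>\<^sub>M i\<in>{..<n}. gauss_vec p (z i \<cdot>\<^sub>v \<theta>)) \<Otimes>\<^sub>M
     ((\<Pi>\<^sub>M i\<in>{..<n}. gauss_vec q (\<sigma> i \<cdot>\<^sub>v \<eta>)) \<Otimes>\<^sub>M
      (\<Pi>\<^sub>M i\<in>{..<n}. measure_pmf (pmf_of_set {..<k})))"

definition part :: "nat \<Rightarrow> (nat \<Rightarrow> nat) \<Rightarrow> nat \<Rightarrow> nat set" where
  "part n d m = {i \<in> {..<n}. d i = m}"

(* The estimator is handed only the observations in the m-th part. *)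
definition est_on_part ::
    "nat \<Rightarrow> nat \<Rightarrow> (nat set \<Rightarrow> (nat \<Rightarrow> real Matrix.vec) \<Rightarrow> real Matrix.vec) \<Rightarrow>
     (nat \<Rightarrow> nat \<Rightarrow> real) \<Rightarrow> (nat \<Rightarrow> nat) \<Rightarrow> nat \<Rightarrow> real Matrix.vec" where
  "est_on_part n p est X d m = est (part n d m) (\<lambda>i\<in>part n d m. Matrix.vec p (X i))"

(* Supremum over z, sigma of the probability of an event.  An arbitrary choice of eigenvectors
   need not make the event measurable, so its outer probability is taken; on measurable events
   this is the probability itself. *)
definition worst_case_prob ::
    "nat \<Rightarrow> nat \<Rightarrow> nat \<Rightarrow> nat \<Rightarrow> real Matrix.vec \<Rightarrow> real Matrix.vec \<Rightarrow>
     ((nat \<Rightarrow> nat \<Rightarrow> real) \<Rightarrow> (nat \<Rightarrow> nat \<Rightarrow> real) \<Rightarrow> (nat \<Rightarrow> nat) \<Rightarrow> bool) \<Rightarrow> ennreal" where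
  "worst_case_prob k n p q \<theta> \<eta> A =
     (SUP z\<in>sign_vectors n. SUP \<sigma>\<in>sign_vectors n.
        outer_measure_of (model k n p q \<theta> \<eta> z \<sigma>)
          {(X, Y, d). (X, Y, d) \<in> space (model k n p q \<theta> \<eta> z \<sigma>) \<and> A X Y d})"

end

theory Submission
  imports Defs "HOL-Real_Asymp.Real_Asymp"
begin

text \<open>Fix one part \<open>D\<close> of the sample and let \<open>S\<close> be its second moment matrix. The signs cancel in
the products \<open>x i $ j * x i $ k\<close>, so \<open>S\<close> has mean \<open>I + \<theta>\<theta>\<^sup>T\<close> for every choice of \<open>z\<close>. Suppose
that the quadratic form of \<open>S\<close> stays within \<open>\<epsilon>\<close> of the form of this mean on the unit sphere.
The Rayleigh quotient of \<open>S\<close> in the direction of \<open>\<theta>\<close> shows that the top eigenvalue \<open>l\<close> is at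
least \<open>1 + |\<theta>|\<^sup>2 - \<epsilon>\<close>, whereas a leading unit eigenvector \<open>u\<close> satisfies
\<open>l = u \<bullet> S u \<le> 1 + (u \<bullet> \<theta>)\<^sup>2 + \<epsilon>\<close>. Hence \<open>(u \<bullet> \<theta>)\<^sup>2 \<ge> |\<theta>|\<^sup>2 - 2\<epsilon>\<close>: the eigenvector is nearly
parallel to \<open>\<theta>\<close>, and \<open>sqrt (l - 1) u\<close> lies within \<open>sqrt (5\<epsilon>)\<close> of \<open>\<theta>\<close> or of \<open>-\<theta>\<close>
(\<open>spectral_estimator_sign_loss\<close>). The argument applies to every choice of the eigenvector.

It remains to control the form uniformly over the sphere with \<open>\<epsilon>\<close> a negative power of \<open>n\<close>.
By polarization it suffices to do so on a grid of \<open>(16p + 1)\<^sup>p\<close> points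
(\<open>quadratic_form_le_of_net\<close>, \<open>grid_vec_near\<close>). For one fixed unit vector \<open>v\<close> the deviation is an
average of independent centred squares of normal variables with mean \<open>\<plusminus>(v \<bullet> \<theta>)\<close> and variance 1,
and Chernoff's method bounds the probability that it exceeds \<open>t\<close> by
\<open>2 exp (- |D| t\<^sup>2 / (16 (1 + |\<theta>|\<^sup>2)))\<close> (\<open>projected_deviation_prob\<close>). The hypotheses on the signal
force \<open>|\<theta>|\<^sup>2\<close> and \<open>|\<eta>|\<^sup>2\<close> to be of exact order \<open>log n\<close> (\<open>norms_of_signal_strength\<close>), and each part
has more than \<open>n/6\<close> members up to an exponentially small probability (\<open>small_part_prob\<close>). With
\<open>t = n powr (- \<delta>/8)\<close> the Gaussian exponent is therefore of order \<open>n powr (1 - \<delta>/4) / log n\<close> and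
exceeds the logarithm of the size of the grid, which is at most of order
\<open>n powr (1 - \<delta>) * log n\<close>. This is where the bound on the dimensions enters, and it leaves a loss of
order \<open>sqrt t = n powr (- \<delta>/16)\<close>, so that \<open>\<gamma> = \<delta>/32\<close> is a valid choice.

The split is independent of the data, so the bound for a fixed part carries over to the random
part by integrating over the split. The events that are estimated concern the sizes of the parts
and the finitely many grid points, hence are measurable; together they cover the failure event of
the estimators, which bounds its outer measure.\<close>

section \<open>Rayleigh quotients and the top eigenvalue\<close>

lemma scalar_prod_self_nonneg: "0 \<le> (v::real Matrix.vec) \<bullet> v"
  by (auto simp: scalar_prod_def intro: sum_nonneg)

lemma two_scalar_prod_le:
  assumes "v \<in> carrier_vec p" "(w::real Matrix.vec) \<in> carrier_vec p"
  shows "2 * \<bar>v \<bullet> w\<bar> \<le> v \<bullet> v + w \<bullet> w"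
proof -
  have "0 \<le> (v - w) \<bullet> (v - w)" "0 \<le> (v + w) \<bullet> (v + w)" by (rule scalar_prod_self_nonneg)+
  moreover have "(v - w) \<bullet> (v - w) = v \<bullet> v - 2 * (v \<bullet> w) + w \<bullet> w"
    using assms by (simp add: minus_scalar_prod_distrib[of _ p] scalar_prod_minus_distrib[of _ p] comm_scalar_prod[of w p v])
  moreover have "(v + w) \<bullet> (v + w) = v \<bullet> v + 2 * (v \<bullet> w) + w \<bullet> w"
    using assms by (simp add: add_scalar_prod_distrib[of _ p] scalar_prod_add_distrib[of _ p] comm_scalar_prod[of w p v])
  ultimately show ?thesis by linarith
qed

lemma scalar_prod_cauchy_schwarz:
  assumes "v \<in> carrier_vec p" "(w::real Matrix.vec) \<in> carrier_vec p"
  shows "(v \<bullet> w)\<^sup>2 \<le> (v \<bullet> v) * (w \<bullet> w)"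
  using assms Cauchy_Schwarz_ineq_sum[of "\<lambda>i. v $ i" "\<lambda>i. w $ i" "{0..<p}"]
  by (simp add: scalar_prod_def power2_eq_square)

text \<open>A crude bound suffices: \<open>C\<close> enters only through its existence. The proof applies the
Cauchy-Schwarz inequality to each row.\<close>

lemma mult_mat_vec_norm_bound:
  fixes A :: "real Matrix.mat"
  assumes A: "A \<in> carrier_mat p p"
  shows "\<exists>C>0. \<forall>v\<in>carrier_vec p. (A *\<^sub>v v) \<bullet> (A *\<^sub>v v) \<le> C * (v \<bullet> v)"
proof (intro exI conjI ballI)
  let ?C = "1 + (\<Sum>i<p. row A i \<bullet> row A i)"
  show "?C > 0" by (simp add: add_pos_nonneg sum_nonneg scalar_prod_self_nonneg)
  fix v :: "real Matrix.vec" assume v: "v \<in> carrier_vec p"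
  have "(A *\<^sub>v v) \<bullet> (A *\<^sub>v v) = (\<Sum>i<p. (row A i \<bullet> v)\<^sup>2)"
    using A by (simp add: scalar_prod_def[of "A *\<^sub>v v"] power2_eq_square lessThan_atLeast0)
  also have "\<dots> \<le> (\<Sum>i<p. (row A i \<bullet> row A i) * (v \<bullet> v))"
    using A v by (intro sum_mono scalar_prod_cauchy_schwarz[of _ p]) auto
  also have "\<dots> = (\<Sum>i<p. (row A i \<bullet> row A i)) * (v \<bullet> v)"
    by (simp add: sum_distrib_right)
  also have "\<dots> \<le> ?C * (v \<bullet> v)"
    using scalar_prod_self_nonneg[of v] by (intro mult_right_mono) auto
  finally show "(A *\<^sub>v v) \<bullet> (A *\<^sub>v v) \<le> ?C * (v \<bullet> v)" .
qed

lemma quadratic_form_bound: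
  fixes A :: "real Matrix.mat"
  assumes A: "A \<in> carrier_mat p p"
  shows "\<exists>C>0. \<forall>v\<in>carrier_vec p. \<bar>v \<bullet> (A *\<^sub>v v)\<bar> \<le> C * (v \<bullet> v)"
proof -
  obtain C where C: "C > 0" "\<And>v. v\<in>carrier_vec p \<Longrightarrow> (A *\<^sub>v v) \<bullet> (A *\<^sub>v v) \<le> C * (v \<bullet> v)"
    using mult_mat_vec_norm_bound[OF A] by blast
  have "\<bar>v \<bullet> (A *\<^sub>v v)\<bar> \<le> (1 + C) * (v \<bullet> v)" if v: "v \<in> carrier_vec p" for v
    using two_scalar_prod_le[OF v, of "A *\<^sub>v v"] C(2)[OF v] v A scalar_prod_self_nonneg[of v]
    by (simp add: algebra_simps) 
  with C(1) show ?thesis by (intro exI[of _ "1 + C"]) auto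
qed

lemma symmetric_form_swap:
  fixes A :: "real Matrix.mat"
  assumes A: "A \<in> carrier_mat p p" "transpose_mat A = A"
    and v: "v \<in> carrier_vec p" and w: "w \<in> carrier_vec p"
  shows "w \<bullet> (A *\<^sub>v v) = v \<bullet> (A *\<^sub>v w)"
  using transpose_vec_mult_scalar[OF A(1) w v] A v w comm_scalar_prod[of "A *\<^sub>v w" p v] 
    comm_scalar_prod[of "A *\<^sub>v v" p w] by auto

lemma quadratic_form_add:
  fixes A :: "real Matrix.mat"
  assumes A: "A \<in> carrier_mat p p" "transpose_mat A = A"
    and v: "v \<in> carrier_vec p" and w: "w \<in> carrier_vec p"
  shows "(v + w) \<bullet> (A *\<^sub>v (v + w)) = v \<bullet> (A *\<^sub>v v) + 2 * (v \<bullet> (A *\<^sub>v w)) + w \<bullet> (A *\<^sub>v w)"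
  using assms symmetric_form_swap[OF A v w]
  by (simp add: mult_add_distrib_mat_vec[of _ p p] add_scalar_prod_distrib[of _ p] scalar_prod_add_distrib[of _ p])

text \<open>For a positive semidefinite \<open>B\<close> a small value of the form at \<open>v\<close> makes \<open>B v\<close> small. This is
obtained by evaluating the form at \<open>v - s (B v)\<close> and choosing the step \<open>s\<close> well.\<close>

lemma psd_image_norm_le_form:
  fixes B :: "real Matrix.mat"
  assumes B: "B \<in> carrier_mat p p" "transpose_mat B = B"
    and psd: "\<And>v. v \<in> carrier_vec p \<Longrightarrow> 0 \<le> v \<bullet> (B *\<^sub>v v)"
  shows "\<exists>K>0. \<forall>v\<in>carrier_vec p. (B *\<^sub>v v) \<bullet> (B *\<^sub>v v) \<le> K * (v \<bullet> (B *\<^sub>v v))"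
proof -
  obtain K where K: "K > 0" "\<And>v. v\<in>carrier_vec p \<Longrightarrow> \<bar>v \<bullet> (B *\<^sub>v v)\<bar> \<le> K * (v \<bullet> v)"
    using quadratic_form_bound[OF B(1)] by blast
  show ?thesis
  proof (intro exI[of _ K] conjI K ballI)
    fix v :: "real Matrix.vec" assume v: "v \<in> carrier_vec p"
    define w where "w = B *\<^sub>v v"
    have w: "w \<in> carrier_vec p" using v B by (simp add: w_def)
    \<comment> \<open>With \<open>w \<bullet> B w \<le> K (w \<bullet> w)\<close>, this step length makes the bound below smallest.\<close>
    define c where "c = - 1 / K"
    have "0 \<le> (v + c \<cdot>\<^sub>v w) \<bullet> (B *\<^sub>v (v + c \<cdot>\<^sub>v w))"
      using v w by (intro psd) auto
    also have "\<dots> = v \<bullet> w + 2 * c * (w \<bullet> w) + c^2 * (w \<bullet> (B *\<^sub>v w))"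
      using v w B symmetric_form_swap[OF B w v]
      by (simp add: quadratic_form_add[OF B] mult_mat_vec[of _ p p] power2_eq_square w_def[symmetric])
    also have "\<dots> \<le> v \<bullet> w + 2 * c * (w \<bullet> w) + c^2 * (K * (w \<bullet> w))"
      using K(2)[OF w] by (intro add_left_mono mult_left_mono) auto
    also have "\<dots> = v \<bullet> w - (w \<bullet> w) / K"
      using K(1) by (simp add: c_def power2_eq_square field_simps)
    finally show "(B *\<^sub>v v) \<bullet> (B *\<^sub>v v) \<le> K * (v \<bullet> (B *\<^sub>v v))"
      using K(1) by (simp add: w_def[symmetric] field_simps)
  qed
qed

lemma finite_eigenvalues:
  assumes "(A :: 'a :: field Matrix.mat) \<in> carrier_mat n n"
  shows "finite {k. eigenvalue A k}"
proof -
  have "char_poly A \<noteq> 0"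
    using degree_monic_char_poly[OF assms] by auto
  then show ?thesis
    unfolding eigenvalue_root_char_poly[OF assms] by (rule poly_roots_finite)
qed

text \<open>The supremum \<open>l\<close> of the Rayleigh quotients is itself an eigenvalue. The matrix
\<open>B = l I - A\<close> is positive semidefinite, and its form takes values arbitrarily close to 0 on the
unit sphere. By \<open>psd_image_norm_le_form\<close> the vectors \<open>B u\<close> then come arbitrarily close to 0 for
unit vectors \<open>u\<close>, which is impossible if \<open>B\<close> has an inverse.\<close>

lemma rayleigh_le_top_eigenvalue:
  fixes A :: "real Matrix.mat"
  assumes A: "A \<in> carrier_mat p p" "transpose_mat A = A" and v: "v \<in> carrier_vec p" "v \<bullet> v = 1"
  shows "v \<bullet> (A *\<^sub>v v) \<le> top_eigenvalue A"
proof -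
  define R where "R = {u \<bullet> (A *\<^sub>v u) | u. u \<in> carrier_vec p \<and> u \<bullet> u = 1}"
  define l where "l = Sup R"
  have vR: "v \<bullet> (A *\<^sub>v v) \<in> R" using v by (auto simp: R_def)
  obtain C where "C > 0" "\<And>v. v\<in>carrier_vec p \<Longrightarrow> \<bar>v \<bullet> (A *\<^sub>v v)\<bar> \<le> C * (v \<bullet> v)"
    using quadratic_form_bound[OF A(1)] by blast
  then have bdd: "bdd_above R"
    by (intro bdd_aboveI[of _ C]) (fastforce simp: R_def)
  have le_l: "u \<bullet> (A *\<^sub>v u) \<le> l" if "u \<in> carrier_vec p" "u \<bullet> u = 1" for u
    unfolding l_def using that by (intro cSup_upper bdd) (auto simp: R_def)
  define B where "B = l \<cdot>\<^sub>m 1\<^sub>m p - A"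
  have B: "B \<in> carrier_mat p p" using A by (auto simp: B_def)
  have Bv: "B *\<^sub>v u = l \<cdot>\<^sub>v u - A *\<^sub>v u" if u: "u \<in> carrier_vec p" for u
  proof -
    have "(l \<cdot>\<^sub>m 1\<^sub>m p) *\<^sub>v u = l \<cdot>\<^sub>v u"
      using u by (intro eq_vecI) auto
    then show ?thesis
      using u A unfolding B_def by (subst minus_mult_distrib_mat_vec[of _ p p]) auto
  qed
  have Bform: "u \<bullet> (B *\<^sub>v u) = l * (u \<bullet> u) - u \<bullet> (A *\<^sub>v u)" if u: "u \<in> carrier_vec p" for u
    using u A unfolding Bv[OF u] by (subst scalar_prod_minus_distrib[of _ p]) auto
  have Bt: "transpose_mat B = B"
    using A unfolding B_def by (subst transpose_minus[of _ p p]) auto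
  have psd: "0 \<le> u \<bullet> (B *\<^sub>v u)" if u: "u \<in> carrier_vec p" for u
  proof (cases "u \<bullet> u = 0")
    case True
    then have "u \<bullet> (A *\<^sub>v u) = 0"
      using scalar_prod_cauchy_schwarz[OF u, of "A *\<^sub>v u"] u A by auto
    with True show ?thesis by (simp add: Bform[OF u])
  next
    case False
    define c where "c = 1 / sqrt (u \<bullet> u)"
    have c: "c * c * (u \<bullet> u) = 1" "c > 0" using False scalar_prod_self_nonneg[of u]
      by (auto simp: c_def field_simps)
    have "(c \<cdot>\<^sub>v u) \<bullet> (A *\<^sub>v (c \<cdot>\<^sub>v u)) \<le> l"
      using u c by (intro le_l) (auto simp: mult.assoc)
    then have "c * c * (u \<bullet> (A *\<^sub>v u)) \<le> c * c * (l * (u \<bullet> u))"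
      using u A c by (simp add: mult_mat_vec[of _ p p] mult.assoc mult.left_commute[of _ l])
    then show ?thesis using c(2) by (simp add: Bform[OF u])
  qed
  have "det B = 0"
  proof (rule ccontr)
    assume "det B \<noteq> 0"
    then obtain C where C: "C \<in> carrier_mat p p" "C * B = 1\<^sub>m p"
      using det_non_zero_imp_unit[OF B, of "()"] by (auto simp: Units_def ring_mat_def)
    obtain c where c: "c > 0" "\<And>v. v\<in>carrier_vec p \<Longrightarrow> (C *\<^sub>v v) \<bullet> (C *\<^sub>v v) \<le> c * (v \<bullet> v)"
      using mult_mat_vec_norm_bound[OF C(1)] by blast
    obtain K where K: "K > 0" "\<And>v. v\<in>carrier_vec p \<Longrightarrow> (B *\<^sub>v v) \<bullet> (B *\<^sub>v v) \<le> K * (v \<bullet> (B *\<^sub>v v))"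
      using psd_image_norm_le_form[OF B Bt psd] by blast
    have "x \<le> l - 1 / (c * K)" if xR: "x \<in> R" for x
    proof -
      obtain u where u: "u \<in> carrier_vec p" "u \<bullet> u = 1" "x = u \<bullet> (A *\<^sub>v u)"
        using xR by (auto simp: R_def)
      \<comment> \<open>\<open>u\<close> is recovered from \<open>B u\<close> by a bounded map, so the form of \<open>B\<close> is bounded away from 0.\<close>
      have "C *\<^sub>v (B *\<^sub>v u) = u"
        using assoc_mult_mat_vec[OF C(1) B u(1)] C(2) u(1) by simp
      then have "1 \<le> c * ((B *\<^sub>v u) \<bullet> (B *\<^sub>v u))"
        using c(2)[of "B *\<^sub>v u"] u B by simp
      also have "\<dots> \<le> c * (K * (u \<bullet> (B *\<^sub>v u)))"
        using K(2)[OF u(1)] c(1) by (intro mult_left_mono) auto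
      also have "\<dots> = c * K * (l - x)" using u by (simp add: Bform)
      finally show ?thesis using c(1) K(1) by (simp add: field_simps)
    qed
    then have "l \<le> l - 1 / (c * K)" unfolding l_def using vR by (intro cSup_least) (auto simp: l_def)
    moreover have "1 / (c * K) > 0" using c K by simp
    ultimately show False by linarith
  qed
  then obtain u where u: "u \<in> carrier_vec p" "u \<noteq> 0\<^sub>v p" "B *\<^sub>v u = 0\<^sub>v p"
    using det_0_iff_vec_prod_zero_field[OF B] by auto
  have "A *\<^sub>v u = l \<cdot>\<^sub>v u"
  proof (rule eq_vecI)
    fix i assume "i < dim_vec (l \<cdot>\<^sub>v u)"
    then have i: "i < p" using u by auto
    have "(B *\<^sub>v u) $ i = 0" using u i by simp
    then show "(A *\<^sub>v u) $ i = (l \<cdot>\<^sub>v u) $ i" unfolding Bv[OF u(1)] using i u A by auto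
  qed (use u A in auto)
  then have "eigenvalue A l" using u A by (auto simp: eigenvalue_def eigenvector_def)
  then have "l \<le> top_eigenvalue A" unfolding top_eigenvalue_def
    using finite_eigenvalues[OF A(1)] by (intro Max_ge) auto
  with le_l[OF v] show ?thesis by linarith
qed

section \<open>Perturbation of the spectral estimator\<close>

lemma second_moment_mat_carrier: "second_moment_mat p D x \<in> carrier_mat p p"
  by (simp add: second_moment_mat_def)

lemma second_moment_mat_symmetric: "transpose_mat (second_moment_mat p D x) = second_moment_mat p D x"
  by (rule eq_matI) (auto simp: second_moment_mat_def mult.commute)

text \<open>Expressed through projections, the form depends on the sample only through the scalars
\<open>v \<bullet> x i\<close>.\<close>

lemma second_moment_mat_form:
  assumes v: "v \<in> carrier_vec p" and x: "\<And>i. i \<in> D \<Longrightarrow> x i \<in> carrier_vec p"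
  shows "v \<bullet> (second_moment_mat p D x *\<^sub>v v) = (1 / real (card D)) * (\<Sum>i\<in>D. (v \<bullet> x i)\<^sup>2)"
proof -
  have "v \<bullet> (second_moment_mat p D x *\<^sub>v v)
      = (\<Sum>j<p. v $ j * (\<Sum>k<p. (1 / real (card D)) * (\<Sum>i\<in>D. x i $ j * x i $ k) * v $ k))"
    using v by (simp add: scalar_prod_def second_moment_mat_def lessThan_atLeast0 row_def)
  also have "\<dots> = (1 / real (card D)) * (\<Sum>j<p. \<Sum>k<p. \<Sum>i\<in>D. (v $ j * x i $ j) * (v $ k * x i $ k))"
    by (simp add: sum_distrib_left sum_distrib_right mult_ac)
  also have "(\<Sum>j<p. \<Sum>k<p. \<Sum>i\<in>D. (v $ j * x i $ j) * (v $ k * x i $ k))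
      = (\<Sum>i\<in>D. \<Sum>j<p. \<Sum>k<p. (v $ j * x i $ j) * (v $ k * x i $ k))"
    by (subst sum.swap[of _ D], subst sum.swap[of _ D]) simp
  also have "\<dots> = (\<Sum>i\<in>D. (v \<bullet> x i)\<^sup>2)"
    using v x by (intro sum.cong refl) 
      (auto simp: scalar_prod_def power2_eq_square sum_product lessThan_atLeast0 dest: carrier_vecD)
  finally show ?thesis .
qed

text \<open>The hypothesis compares \<open>S\<close> with \<open>I + \<theta>\<theta>\<^sup>T\<close>. It is used at two vectors: at \<open>\<theta>\<close>, normalised,
where it bounds the top eigenvalue \<open>l\<close> from below, and at the leading eigenvector \<open>u\<close>, where it ties
\<open>l - 1\<close> to \<open>(u \<bullet> \<theta>)\<^sup>2\<close>. Both \<open>l - 1\<close> and \<open>(u \<bullet> \<theta>)\<^sup>2\<close> are thus at least \<open>|\<theta>|\<^sup>2 - 2\<epsilon>\<close>, so the cross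
term \<open>2 sqrt (l - 1) |u \<bullet> \<theta>|\<close> nearly exhausts the squared norms \<open>(l - 1) + |\<theta>|\<^sup>2\<close>. The condition
\<open>2\<epsilon> \<le> |\<theta>|\<^sup>2\<close> keeps the estimator away from its degenerate value 0.\<close>

lemma spectral_estimator_sign_loss:
  assumes est: "spectral_estimator p est"
    and D: "finite D" "D \<noteq> {}" and x: "\<And>i. i \<in> D \<Longrightarrow> x i \<in> carrier_vec p"
    and \<theta>: "\<theta> \<in> carrier_vec p" and \<epsilon>: "0 < \<epsilon>" "2 * \<epsilon> \<le> \<theta> \<bullet> \<theta>"
    and dev: "\<And>v. v \<in> carrier_vec p \<Longrightarrow> v \<bullet> v = 1 \<Longrightarrow>
      \<bar>v \<bullet> (second_moment_mat p D x *\<^sub>v v) - 1 - (v \<bullet> \<theta>)\<^sup>2\<bar> \<le> \<epsilon>"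
  shows "sign_loss (est D x) \<theta> \<le> sqrt (5 * \<epsilon>)"
proof -
  define S where "S = second_moment_mat p D x"
  define l where "l = top_eigenvalue S"
  have S: "S \<in> carrier_mat p p" "transpose_mat S = S"
    unfolding S_def by (rule second_moment_mat_carrier second_moment_mat_symmetric)+
  define c where "c = 1 / sqrt (\<theta> \<bullet> \<theta>)"
  have c: "c * (c * (\<theta> \<bullet> \<theta>)) = 1" using \<epsilon> by (simp add: c_def field_simps)
  have cc: "(c * (\<theta> \<bullet> \<theta>))\<^sup>2 = \<theta> \<bullet> \<theta>"
    using \<epsilon> by (simp add: c_def power2_eq_square field_simps)
  have "1 + \<theta> \<bullet> \<theta> - \<epsilon> \<le> (c \<cdot>\<^sub>v \<theta>) \<bullet> (S *\<^sub>v (c \<cdot>\<^sub>v \<theta>))"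
    using dev[of "c \<cdot>\<^sub>v \<theta>"] \<theta> c cc by (simp add: S_def)
  also have "\<dots> \<le> l"
    unfolding l_def using \<theta> c by (intro rayleigh_le_top_eigenvalue[OF S]) auto
  finally have l: "1 + \<theta> \<bullet> \<theta> - \<epsilon> \<le> l" .
  then have l1: "\<not> l < 1" using \<epsilon> by linarith
  from est D x obtain u where u: "eigenvector S u l" "l2_norm u = 1"
      and est_u: "est D x = sqrt (l - 1) \<cdot>\<^sub>v u"
    using l1 unfolding spectral_estimator_def Let_def S_def l_def by metis
  have uc: "u \<in> carrier_vec p" and Su: "S *\<^sub>v u = l \<cdot>\<^sub>v u"
    using u(1) S by (auto simp: eigenvector_def)
  have uu: "u \<bullet> u = 1" using u(2) by (simp add: l2_norm_def)
  have u\<theta>: "\<bar>l - 1 - (u \<bullet> \<theta>)\<^sup>2\<bar> \<le> \<epsilon>"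
    using dev[OF uc uu] uc uu by (simp add: S_def[symmetric] Su)
  have u\<theta>2: "(u \<bullet> \<theta>)\<^sup>2 \<le> \<theta> \<bullet> \<theta>" using scalar_prod_cauchy_schwarz[OF uc \<theta>] uu by simp
  define k where "k = sqrt (l - 1)"
  have k: "k \<ge> 0" "k\<^sup>2 = l - 1" using l1 by (auto simp: k_def)
  have "\<theta> \<bullet> \<theta> - 2 * \<epsilon> = sqrt (\<theta> \<bullet> \<theta> - 2 * \<epsilon>) * sqrt (\<theta> \<bullet> \<theta> - 2 * \<epsilon>)" using \<epsilon> by simp
  also have "\<dots> \<le> k * \<bar>u \<bullet> \<theta>\<bar>"
    using l u\<theta> \<epsilon> k by (intro mult_mono) (auto simp: k_def intro!: real_le_lsqrt)
  finally have prod: "\<theta> \<bullet> \<theta> - 2 * \<epsilon> \<le> k * \<bar>u \<bullet> \<theta>\<bar>" .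
  have minus: "(k \<cdot>\<^sub>v u - \<theta>) \<bullet> (k \<cdot>\<^sub>v u - \<theta>) = k\<^sup>2 - 2 * (k * (u \<bullet> \<theta>)) + \<theta> \<bullet> \<theta>"
    using uc \<theta> uu comm_scalar_prod[OF \<theta> uc]
    by (simp add: minus_scalar_prod_distrib[of _ p] scalar_prod_minus_distrib[of _ p] power2_eq_square algebra_simps)
  have plus: "(k \<cdot>\<^sub>v u + \<theta>) \<bullet> (k \<cdot>\<^sub>v u + \<theta>) = k\<^sup>2 + 2 * (k * (u \<bullet> \<theta>)) + \<theta> \<bullet> \<theta>"
    using uc \<theta> uu comm_scalar_prod[OF \<theta> uc]
    by (simp add: add_scalar_prod_distrib[of _ p] scalar_prod_add_distrib[of _ p] power2_eq_square algebra_simps)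
  have "min ((k \<cdot>\<^sub>v u - \<theta>) \<bullet> (k \<cdot>\<^sub>v u - \<theta>)) ((k \<cdot>\<^sub>v u + \<theta>) \<bullet> (k \<cdot>\<^sub>v u + \<theta>)) \<le> 5 * \<epsilon>"
    using prod u\<theta> u\<theta>2 k unfolding minus plus by (cases "u \<bullet> \<theta> \<ge> 0") auto
  then show ?thesis
    unfolding sign_loss_def est_u k_def[symmetric] l2_norm_def by (auto simp: min_le_iff_disj)
qed

section \<open>Reduction of a quadratic form to a finite grid\<close>

text \<open>Let \<open>M\<close> be the supremum of the form on the unit ball. Polarization bounds the associated
bilinear form by \<open>M\<close> as well, so moving from a point of the ball to its neighbour in \<open>N\<close> changes the
form by a fixed fraction of \<open>M\<close> at most, which can be absorbed.\<close>

lemma quadratic_form_le_of_net: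
  fixes A :: "real Matrix.mat"
  assumes A: "A \<in> carrier_mat p p" "transpose_mat A = A"
    and N: "N \<subseteq> carrier_vec p"
    and net: "\<And>u. u \<in> carrier_vec p \<Longrightarrow> u \<bullet> u \<le> 1 \<Longrightarrow> \<exists>v\<in>N. (u - v) \<bullet> (u - v) \<le> 1/64"
    and t: "t \<ge> 0" and le: "\<And>v. v \<in> N \<Longrightarrow> \<bar>v \<bullet> (A *\<^sub>v v)\<bar> \<le> t * (v \<bullet> v)"
    and u: "u \<in> carrier_vec p" "u \<bullet> u \<le> 1"
  shows "\<bar>u \<bullet> (A *\<^sub>v u)\<bar> \<le> 2 * t"
proof -
  define R where "R = {\<bar>u \<bullet> (A *\<^sub>v u)\<bar> | u. u \<in> carrier_vec p \<and> u \<bullet> u \<le> 1}"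
  define M where "M = Sup R"
  have uR: "\<bar>u \<bullet> (A *\<^sub>v u)\<bar> \<in> R" using u by (auto simp: R_def)
  obtain C where C: "C > 0" "\<And>v. v\<in>carrier_vec p \<Longrightarrow> \<bar>v \<bullet> (A *\<^sub>v v)\<bar> \<le> C * (v \<bullet> v)"
    using quadratic_form_bound[OF A(1)] by blast
  have bdd: "bdd_above R"
  proof (rule bdd_aboveI)
    fix r assume "r \<in> R"
    then obtain v where v: "v \<in> carrier_vec p" "v \<bullet> v \<le> 1" "r = \<bar>v \<bullet> (A *\<^sub>v v)\<bar>"
      by (auto simp: R_def)
    have "r \<le> C * (v \<bullet> v)" using C(2) v by simp
    also have "\<dots> \<le> C * 1" using v C(1) by (intro mult_left_mono) auto
    finally show "r \<le> C" by simp
  qed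
  have le_M1: "\<bar>v \<bullet> (A *\<^sub>v v)\<bar> \<le> M" if "v \<in> carrier_vec p" "v \<bullet> v \<le> 1" for v
    unfolding M_def using that by (intro cSup_upper bdd) (auto simp: R_def)
  have M0: "0 \<le> M" using le_M1[OF u] by linarith
  have le_M: "\<bar>v \<bullet> (A *\<^sub>v v)\<bar> \<le> M * (v \<bullet> v)" if v: "v \<in> carrier_vec p" for v
  proof (cases "v \<bullet> v = 0")
    case True
    then show ?thesis using C(2)[OF v] by simp
  next
    case False
    define c where "c = 1 / sqrt (v \<bullet> v)"
    have c: "c * c * (v \<bullet> v) = 1" "c > 0" using False scalar_prod_self_nonneg[of v]
      by (auto simp: c_def field_simps)
    have "\<bar>(c \<cdot>\<^sub>v v) \<bullet> (A *\<^sub>v (c \<cdot>\<^sub>v v))\<bar> \<le> M"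
      using v c by (intro le_M1) (auto simp: mult.assoc)
    then have "c * c * \<bar>v \<bullet> (A *\<^sub>v v)\<bar> \<le> c * c * (M * (v \<bullet> v))"
      using v A c by (simp add: mult_mat_vec[of _ p p] mult.assoc mult.left_commute[of _ M] abs_mult)
    then show ?thesis using c(2) by simp
  qed
  have polar: "2 * \<bar>v \<bullet> (A *\<^sub>v w)\<bar> \<le> M * (v \<bullet> v + w \<bullet> w)"
    if v: "v \<in> carrier_vec p" and w: "w \<in> carrier_vec p" for v w
  proof -
    have 1: "(v + w) \<bullet> (A *\<^sub>v (v + w)) = v \<bullet> (A *\<^sub>v v) + 2 * (v \<bullet> (A *\<^sub>v w)) + w \<bullet> (A *\<^sub>v w)"
      by (rule quadratic_form_add[OF A v w])
    have 2: "(v + -1 \<cdot>\<^sub>v w) \<bullet> (A *\<^sub>v (v + -1 \<cdot>\<^sub>v w)) = v \<bullet> (A *\<^sub>v v) - 2 * (v \<bullet> (A *\<^sub>v w)) + w \<bullet> (A *\<^sub>v w)"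
      using v w A by (subst quadratic_form_add[OF A v]) (auto simp: mult_mat_vec[of _ p p])
    have 3: "(v + w) \<bullet> (v + w) = v \<bullet> v + 2 * (v \<bullet> w) + w \<bullet> w"
      using v w by (simp add: add_scalar_prod_distrib[of _ p] scalar_prod_add_distrib[of _ p] comm_scalar_prod[of w p v])
    have 4: "(v + -1 \<cdot>\<^sub>v w) \<bullet> (v + -1 \<cdot>\<^sub>v w) = v \<bullet> v - 2 * (v \<bullet> w) + w \<bullet> w"
      using v w by (simp add: add_scalar_prod_distrib[of _ p] scalar_prod_add_distrib[of _ p] comm_scalar_prod[of w p v])
    have "4 * \<bar>v \<bullet> (A *\<^sub>v w)\<bar> \<le> M * ((v + w) \<bullet> (v + w)) + M * ((v + -1 \<cdot>\<^sub>v w) \<bullet> (v + -1 \<cdot>\<^sub>v w))"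
      using le_M[of "v + w"] le_M[of "v + -1 \<cdot>\<^sub>v w"] v w unfolding 1 2 by auto
    also have "\<dots> = 2 * (M * (v \<bullet> v + w \<bullet> w))" unfolding 3 4 by (simp add: algebra_simps)
    finally show ?thesis by simp
  qed
  \<comment> \<open>The distance to the net is at most \<open>1/8\<close>, so \<open>v \<bullet> v \<le> (9/8)\<^sup>2 = 81/64\<close>; the mixed term is
    bounded by \<open>145/512 M\<close> and the square of the increment by \<open>8/512 M\<close>.\<close>
  have "r \<le> 81/64 * t + 153/512 * M" if rR: "r \<in> R" for r
  proof -
    obtain y where y: "y \<in> carrier_vec p" "y \<bullet> y \<le> 1" "r = \<bar>y \<bullet> (A *\<^sub>v y)\<bar>"
      using rR by (auto simp: R_def)
    obtain v where vN: "v \<in> N" and d64: "(y - v) \<bullet> (y - v) \<le> 1/64" using net y by blast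
    then have v: "v \<in> carrier_vec p" using N by auto
    define d where "d = y - v"
    have d: "d \<in> carrier_vec p" "d \<bullet> d \<le> 1/64" using y v d64 by (auto simp: d_def)
    have yvd: "y = v + d" using y v by (auto simp: d_def intro: eq_vecI)
    have vyd: "v = y + -1 \<cdot>\<^sub>v d" using y v by (auto simp: d_def intro: eq_vecI)
    \<comment> \<open>Scaling \<open>d\<close> by 8 gives both arguments norm at most 1, where the bound by the arithmetic mean
      is as good as the Cauchy-Schwarz inequality.\<close>
    have "2 * \<bar>y \<bullet> (8 \<cdot>\<^sub>v d)\<bar> \<le> y \<bullet> y + (8 \<cdot>\<^sub>v d) \<bullet> (8 \<cdot>\<^sub>v d)"
      using y d by (intro two_scalar_prod_le[of _ p]) auto
    then have yd: "8 * \<bar>y \<bullet> d\<bar> \<le> 1" using y d by (simp add: abs_mult)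
    have "v \<bullet> v = y \<bullet> y - 2 * (y \<bullet> d) + d \<bullet> d"
      unfolding vyd using y d by (simp add: add_scalar_prod_distrib[of _ p] scalar_prod_add_distrib[of _ p] comm_scalar_prod[of d p y])
    then have vv: "v \<bullet> v \<le> 81/64" using yd y(2) d(2) by auto
    have "2 * \<bar>v \<bullet> (A *\<^sub>v (8 \<cdot>\<^sub>v d))\<bar> \<le> M * (v \<bullet> v + (8 \<cdot>\<^sub>v d) \<bullet> (8 \<cdot>\<^sub>v d))"
      using v d by (intro polar) auto
    also have "\<dots> \<le> M * (81/64 + 1)" using vv d by (intro mult_left_mono M0) auto
    finally have c: "2 * \<bar>v \<bullet> (A *\<^sub>v d)\<bar> \<le> M * (145/512)"
      using A v d by (simp add: mult_mat_vec[of _ p p] abs_mult)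
    have "\<bar>d \<bullet> (A *\<^sub>v d)\<bar> \<le> M * (d \<bullet> d)" using d by (intro le_M)
    also have "\<dots> \<le> M * (1/64)" using d by (intro mult_left_mono M0) auto
    finally have dd: "\<bar>d \<bullet> (A *\<^sub>v d)\<bar> \<le> M * (1/64)" .
    have "t * (v \<bullet> v) \<le> t * (81/64)" using vv t by (intro mult_left_mono)
    then have "\<bar>v \<bullet> (A *\<^sub>v v)\<bar> \<le> 81/64 * t" using le[OF vN] by simp
    moreover have "y \<bullet> (A *\<^sub>v y) = v \<bullet> (A *\<^sub>v v) + 2 * (v \<bullet> (A *\<^sub>v d)) + d \<bullet> (A *\<^sub>v d)"
      unfolding yvd by (rule quadratic_form_add[OF A v d(1)])
    ultimately show ?thesis using c dd unfolding y(3) by linarith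
  qed
  then have "M \<le> 81/64 * t + 153/512 * M" unfolding M_def using uR by (intro cSup_least) (auto simp: M_def)
  then show ?thesis using le_M1[OF u] t by linarith
qed

text \<open>Spacing \<open>1/(8p)\<close> makes the rounding error at most \<open>sqrt p / (8p) \<le> 1/8\<close>. The logarithm of the
number of points exceeds the best possible order \<open>p\<close> by a factor \<open>log p\<close>, which the polynomial gap
between \<open>p\<close> and \<open>n\<close> absorbs.\<close>

definition grid_vec :: "nat \<Rightarrow> (nat \<Rightarrow> int) \<Rightarrow> real Matrix.vec" where
  "grid_vec p k = Matrix.vec p (\<lambda>j. real_of_int (k j) / (8 * real p))"

definition grid_index :: "nat \<Rightarrow> (nat \<Rightarrow> int) set" where
  "grid_index p = {..<p} \<rightarrow>\<^sub>E {- int (8 * p)..int (8 * p)}"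

lemma grid_vec_carrier: "grid_vec p k \<in> carrier_vec p"
  by (simp add: grid_vec_def)

lemma finite_grid_index: "finite (grid_index p)"
  unfolding grid_index_def by (intro finite_PiE) auto

lemma card_grid_index: "card (grid_index p) = (16 * p + 1) ^ p"
  unfolding grid_index_def by (subst card_PiE) (auto simp: nat_add_distrib nat_mult_distrib)

lemma grid_vec_near:
  assumes u: "u \<in> carrier_vec p" "u \<bullet> u \<le> 1" and p: "p > 0"
  shows "\<exists>k\<in>grid_index p. (u - grid_vec p k) \<bullet> (u - grid_vec p k) \<le> 1/64"
proof
  define h where "h = 1 / (8 * real p)"
  have h: "h > 0" "8 * real p = 1 / h" using p by (auto simp: h_def)
  define k where "k = (\<lambda>j\<in>{..<p}. \<lfloor>u $ j / h\<rfloor>)"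
  have le: "\<bar>u $ j\<bar> \<le> 1" if "j < p" for j
  proof -
    have "(u $ j)\<^sup>2 \<le> (\<Sum>i\<in>{0..<p}. (u $ i)\<^sup>2)" using that by (intro member_le_sum) auto
    also have "\<dots> \<le> 1" using u by (simp add: scalar_prod_def power2_eq_square)
    finally show ?thesis by (simp add: abs_square_le_1)
  qed
  show "k \<in> grid_index p"
  proof -
    have "\<lfloor>u $ j / h\<rfloor> \<in> {- int (8 * p)..int (8 * p)}" if "j < p" for j
    proof -
      have "\<bar>u $ j / h\<bar> \<le> 8 * real p" unfolding h(2) using le[OF that] h(1) by (simp add: abs_divide divide_right_mono)
      then have "- real (8 * p) \<le> u $ j / h" "u $ j / h \<le> real (8 * p)" unfolding abs_le_iff by auto
      then show ?thesis by (simp add: le_floor_iff floor_le_iff)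
    qed
    then show ?thesis by (auto simp: k_def grid_index_def)
  qed
  have "(u - grid_vec p k) \<bullet> (u - grid_vec p k) = (\<Sum>j<p. (u $ j - h * of_int (k j))\<^sup>2)"
    using u by (simp add: scalar_prod_def grid_vec_def power2_eq_square lessThan_atLeast0 h_def)
  also have "\<dots> \<le> (\<Sum>j<p. h\<^sup>2)"
  proof (intro sum_mono)
    fix j assume "j \<in> {..<p}"
    then have kj: "k j = \<lfloor>u $ j / h\<rfloor>" by (simp add: k_def)
    have "0 \<le> u $ j / h - of_int (k j)" "u $ j / h - of_int (k j) \<le> 1" unfolding kj by linarith+
    then have "0 \<le> u $ j - h * of_int (k j)" "u $ j - h * of_int (k j) \<le> h"
      using h(1) by (auto simp: field_simps)
    then show "(u $ j - h * of_int (k j))\<^sup>2 \<le> h\<^sup>2" by (intro power_mono) auto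
  qed
  also have "\<dots> \<le> 1/64" using p by (simp add: h_def power2_eq_square field_simps)
  finally show "(u - grid_vec p k) \<bullet> (u - grid_vec p k) \<le> 1/64" .
qed

section \<open>Exponential moments of squared Gaussian projections\<close>

text \<open>The exponential of the sum is a product of functions of single coordinates, so its integral
factorises; Markov's inequality does the rest.\<close>

lemma product_chernoff_bound:
  fixes h :: "'i \<Rightarrow> 'a \<Rightarrow> real"
  assumes I: "finite I" and M: "\<And>i. prob_space (M i)"
    and h[measurable]: "\<And>i. i \<in> I \<Longrightarrow> h i \<in> borel_measurable (M i)"
    and mgf: "\<And>i. i \<in> I \<Longrightarrow> (\<integral>\<^sup>+x. ennreal (exp (h i x)) \<partial>M i) \<le> ennreal (exp (c i))"
  shows "emeasure (PiM I M) {x \<in> space (PiM I M). T \<le> (\<Sum>i\<in>I. h i (x i))}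
    \<le> ennreal (exp ((\<Sum>i\<in>I. c i) - T))"
proof -
  interpret product_prob_space M by (intro product_prob_spaceI M)
  let ?P = "PiM I M"
  let ?f = "\<lambda>x. \<Prod>i\<in>I. ennreal (exp (h i (x i)))"
  have meas[measurable]: "?f \<in> borel_measurable ?P"
    by (intro borel_measurable_prod_ennreal) measurable
  have f_eq: "?f x = ennreal (exp (\<Sum>i\<in>I. h i (x i)))" for x
    by (simp add: exp_sum[OF I] prod_ennreal)
  have "{x \<in> space ?P. T \<le> (\<Sum>i\<in>I. h i (x i))} = {x \<in> space ?P. 1 \<le> ennreal (exp (- T)) * ?f x}"
    unfolding f_eq ennreal_mult''[symmetric, OF exp_ge_zero] ennreal_1[symmetric]
    by (subst ennreal_le_iff) (auto simp: mult_exp_exp)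
  also have "emeasure ?P \<dots> \<le> ennreal (exp (- T)) * (\<integral>\<^sup>+x. ?f x * indicator (space ?P) x \<partial>?P)"
    by (rule nn_integral_Markov_inequality) simp_all
  also have "(\<integral>\<^sup>+x. ?f x * indicator (space ?P) x \<partial>?P) = (\<integral>\<^sup>+x. ?f x \<partial>?P)"
    by (intro nn_integral_cong) simp
  also have "\<dots> = (\<Prod>i\<in>I. \<integral>\<^sup>+x. ennreal (exp (h i x)) \<partial>M i)"
    by (intro product_nn_integral_prod I) measurable
  also have "\<dots> \<le> (\<Prod>i\<in>I. ennreal (exp (c i)))"
    by (intro prod_mono_ennreal mgf)
  also have "\<dots> = ennreal (exp (\<Sum>i\<in>I. c i))"
    by (simp add: exp_sum[OF I] prod_ennreal)
  also have "ennreal (exp (- T)) * \<dots> = ennreal (exp ((\<Sum>i\<in>I. c i) - T))"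
    by (simp add: ennreal_mult''[symmetric] mult_exp_exp)
  finally show ?thesis by (simp add: mult_left_mono)
qed

lemma nn_integral_normal_density:
  "0 < \<sigma> \<Longrightarrow> (\<integral>\<^sup>+x. ennreal (normal_density \<mu> \<sigma> x) \<partial>lborel) = 1"
  using prob_space.emeasure_space_1[OF prob_space_normal_density, of \<sigma> \<mu>]
  by (simp add: emeasure_density)

lemma normal_square_mgf:
  assumes l: "l < 1/2"
  shows "(\<integral>\<^sup>+x. ennreal (exp (l * x\<^sup>2)) \<partial>density lborel (normal_density \<mu> 1))
    = ennreal (exp (l * \<mu>\<^sup>2 / (1 - 2 * l)) / sqrt (1 - 2 * l))"
proof -
  define b where "b = 1 - 2 * l"
  have b: "b > 0" "l = (1 - b) / 2" using l by (auto simp: b_def)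
  \<comment> \<open>Completing the square turns the integrand into a multiple of a normal density with
    variance \<open>1/b\<close>.\<close>
  have eq: "normal_density \<mu> 1 x * exp (l * x\<^sup>2)
      = exp (l * \<mu>\<^sup>2 / b) / sqrt b * normal_density (\<mu> / b) (1 / sqrt b) x" for x
  proof -
    have "- (x - \<mu>)\<^sup>2 / 2 + l * x\<^sup>2 = l * \<mu>\<^sup>2 / b - (x - \<mu> / b)\<^sup>2 * b / 2"
      unfolding b(2) using b(1) by (simp add: field_simps power2_eq_square)
    then have "exp (- (x - \<mu>)\<^sup>2 / 2) * exp (l * x\<^sup>2) = exp (l * \<mu>\<^sup>2 / b) * exp (- ((x - \<mu> / b)\<^sup>2 * b / 2))"
      by (simp add: mult_exp_exp)
    moreover have "normal_density \<mu> 1 x = exp (- (x - \<mu>)\<^sup>2 / 2) / sqrt (2 * pi)"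
      by (simp add: normal_density_def)
    moreover have "normal_density (\<mu> / b) (1 / sqrt b) x
        = exp (- ((x - \<mu> / b)\<^sup>2 * b / 2)) * sqrt b / sqrt (2 * pi)"
      using b(1) by (simp add: normal_density_def power_divide real_sqrt_divide)
    ultimately show ?thesis using b(1) by simp
  qed
  have "(\<integral>\<^sup>+x. ennreal (exp (l * x\<^sup>2)) \<partial>density lborel (normal_density \<mu> 1))
      = (\<integral>\<^sup>+x. ennreal (normal_density \<mu> 1 x * exp (l * x\<^sup>2)) \<partial>lborel)"
    by (subst nn_integral_density) (auto simp: ennreal_mult''[symmetric])
  also have "\<dots> = (\<integral>\<^sup>+x. ennreal (exp (l * \<mu>\<^sup>2 / b) / sqrt b) * ennreal (normal_density (\<mu> / b) (1 / sqrt b) x) \<partial>lborel)"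
    unfolding eq using b by (intro nn_integral_cong) (simp add: ennreal_mult''[symmetric])
  also have "\<dots> = ennreal (exp (l * \<mu>\<^sup>2 / b) / sqrt b)"
    using b(1) by (subst nn_integral_cmult) (auto simp: nn_integral_normal_density)
  finally show ?thesis by (simp add: b_def)
qed

text \<open>The square of a normal variable is sub-exponential: near \<open>l = 0\<close> its centred exponential moment
is that of a Gaussian whose variance is of order \<open>1 + \<mu>\<^sup>2\<close>. The restriction on \<open>l\<close> keeps \<open>1 - 2l\<close>
above \<open>1/2\<close>, which is what the second-order bound for the logarithm asks for.\<close>

lemma centred_normal_square_mgf_le:
  assumes l: "\<bar>l\<bar> \<le> 1/4"
  shows "(\<integral>\<^sup>+x. ennreal (exp (l * (x\<^sup>2 - \<mu>\<^sup>2 - 1))) \<partial>density lborel (normal_density \<mu> 1))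
    \<le> ennreal (exp (4 * l\<^sup>2 * (1 + \<mu>\<^sup>2)))"
proof -
  have b: "1 - 2 * l \<ge> 1/2" using l by linarith
  have "(\<integral>\<^sup>+x. ennreal (exp (l * (x\<^sup>2 - \<mu>\<^sup>2 - 1))) \<partial>density lborel (normal_density \<mu> 1))
      = (\<integral>\<^sup>+x. ennreal (exp (- l * \<mu>\<^sup>2 - l)) * ennreal (exp (l * x\<^sup>2)) \<partial>density lborel (normal_density \<mu> 1))"
    by (intro nn_integral_cong) (auto simp: ennreal_mult''[symmetric] mult_exp_exp algebra_simps)
  also have "\<dots> = ennreal (exp (- l * \<mu>\<^sup>2 - l) * (exp (l * \<mu>\<^sup>2 / (1 - 2 * l)) / sqrt (1 - 2 * l)))"
    using l b by (subst nn_integral_cmult) (auto simp: normal_square_mgf ennreal_mult''[symmetric])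
  also have "\<dots> \<le> ennreal (exp (4 * l\<^sup>2 * (1 + \<mu>\<^sup>2)))"
  proof (rule ennreal_leI)
    have "\<bar>ln (1 + - (2 * l)) - (- (2 * l))\<bar> \<le> 2 * (- (2 * l))\<^sup>2"
      using l by (intro abs_ln_one_plus_x_minus_x_bound) auto
    then have ln: "- ln (1 - 2 * l) / 2 - l \<le> 4 * l\<^sup>2" by (simp add: power2_eq_square)
    have "sqrt (1 - 2 * l) = exp (ln (1 - 2 * l) / 2)"
      using b by (simp add: ln_sqrt[symmetric])
    then have s: "1 / sqrt (1 - 2 * l) = exp (- ln (1 - 2 * l) / 2)"
      by (simp add: exp_minus field_simps)
    have "l\<^sup>2 * \<mu>\<^sup>2 * 1 \<le> l\<^sup>2 * \<mu>\<^sup>2 * (2 * (1 - 2 * l))" using b by (intro mult_left_mono) auto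
    then have m: "l * \<mu>\<^sup>2 / (1 - 2 * l) - l * \<mu>\<^sup>2 \<le> 4 * l\<^sup>2 * \<mu>\<^sup>2"
      using b by (simp add: field_simps power2_eq_square)
    have "exp (- l * \<mu>\<^sup>2 - l) * (exp (l * \<mu>\<^sup>2 / (1 - 2 * l)) / sqrt (1 - 2 * l))
       = exp (- l * \<mu>\<^sup>2 - l) * (exp (l * \<mu>\<^sup>2 / (1 - 2 * l)) * (1 / sqrt (1 - 2 * l)))" by simp
    also have "\<dots> = exp ((l * \<mu>\<^sup>2 / (1 - 2 * l) - l * \<mu>\<^sup>2) + (- ln (1 - 2 * l) / 2 - l))"
      unfolding s by (simp add: mult_exp_exp)
    also have "\<dots> \<le> exp (4 * l\<^sup>2 * (1 + \<mu>\<^sup>2))"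
      using ln m by (simp add: algebra_simps)
    finally show "exp (- l * \<mu>\<^sup>2 - l) * (exp (l * \<mu>\<^sup>2 / (1 - 2 * l)) / sqrt (1 - 2 * l))
      \<le> exp (4 * l\<^sup>2 * (1 + \<mu>\<^sup>2))" .
  qed
  finally show ?thesis .
qed

lemma prob_space_gauss_vec: "prob_space (gauss_vec p w)"
  unfolding gauss_vec_def by (intro prob_space_PiM prob_space_normal_density) simp

lemma indep_vars_PiM_coordinates:
  assumes "I \<noteq> {}" "finite I" "\<And>i. prob_space (M i)"
  shows "prob_space.indep_vars (PiM I M) M (\<lambda>i x. x i) I"
proof -
  interpret product_prob_space M by (intro product_prob_spaceI assms)
  have P: "prob_space (PiM I M)" by (intro prob_space_PiM assms)
  have "distr (PiM I M) (PiM I M) (\<lambda>x. \<lambda>i\<in>I. x i) = PiM I M"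
    by (rule distr_PiM_restrict_finite) (use assms in auto)
  moreover have "(\<Pi>\<^sub>M i\<in>I. distr (PiM I M) (M i) (\<lambda>x. x i)) = PiM I M"
    by (intro PiM_cong refl distr_PiM_component assms)
  ultimately show ?thesis
    using assms by (subst prob_space.indep_vars_iff_distr_eq_PiM'[OF P]) auto
qed

text \<open>Rotation invariance in the form of the additivity of independent normal variables.\<close>

lemma gauss_vec_unit_projection:
  assumes v: "v \<in> carrier_vec p" "v \<bullet> v = 1" and w: "w \<in> carrier_vec p"
  shows "distr (gauss_vec p w) borel (\<lambda>x. v \<bullet> Matrix.vec p x) = density lborel (normal_density (v \<bullet> w) 1)"
proof -
  define M where "M = (\<lambda>j. density lborel (normal_density (w $ j) 1))"
  have M: "prob_space (M j)" for j unfolding M_def by (rule prob_space_normal_density) simp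
  have g: "gauss_vec p w = PiM {..<p} M" by (simp add: gauss_vec_def M_def)
  interpret P: prob_space "PiM {..<p} M" by (intro prob_space_PiM M)
  \<comment> \<open>Coordinates with weight 0 contribute no normal variable and are left out of the sum.\<close>
  define J where "J = {j \<in> {..<p}. v $ j \<noteq> 0}"
  have sumJ: "(\<Sum>j\<in>J. v $ j * y j) = (\<Sum>j<p. v $ j * y j)" for y :: "nat \<Rightarrow> real"
    unfolding J_def by (rule sum.mono_neutral_left) auto
  have vv: "(\<Sum>j<p. v $ j * v $ j) = 1" using v by (simp add: scalar_prod_def lessThan_atLeast0)
  have "J \<noteq> {}" using sumJ[of "\<lambda>j. v $ j"] vv by auto
  have p: "{..<p} \<noteq> {}" using \<open>J \<noteq> {}\<close> by (auto simp: J_def)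
  have "P.indep_vars M (\<lambda>j x. x j) {..<p}"
    using p by (intro indep_vars_PiM_coordinates M) auto
  then have "P.indep_vars M (\<lambda>j x. x j) J" by (rule P.indep_vars_subset) (auto simp: J_def)
  then have ind: "P.indep_vars (\<lambda>_. borel) (\<lambda>j x. v $ j * x j) J"
    by (rule P.indep_vars_compose2) (auto simp: M_def)
  have "distributed (PiM {..<p} M) lborel (\<lambda>x. \<Sum>j\<in>J. v $ j * x j)
    (normal_density (\<Sum>j\<in>J. v $ j * w $ j) (sqrt (\<Sum>j\<in>J. \<bar>v $ j\<bar>\<^sup>2)))"
  proof (rule P.sum_indep_normal[OF _ \<open>J \<noteq> {}\<close> ind])
    fix j assume j: "j \<in> J"
    then show "0 < \<bar>v $ j\<bar>" by (simp add: J_def)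
    have "distr (PiM {..<p} M) lborel (\<lambda>x. x j) = distr (PiM {..<p} M) (M j) (\<lambda>x. x j)"
      by (intro distr_cong) (auto simp: M_def)
    also have "\<dots> = M j" using j by (intro distr_PiM_component M) (auto simp: J_def)
    finally have "distributed (PiM {..<p} M) lborel (\<lambda>x. x j) (normal_density (w $ j) 1)"
      using j by (auto simp: distributed_def M_def J_def intro!: measurable_component_singleton[where M=M, unfolded M_def] cong: measurable_cong_sets)
    from P.normal_density_affine[OF this, of "v $ j" 0] j
    show "distributed (PiM {..<p} M) lborel (\<lambda>x. v $ j * x j) (normal_density (v $ j * w $ j) \<bar>v $ j\<bar>)"
      by (simp add: J_def)
  qed (simp add: J_def)
  then have D: "distributed (PiM {..<p} M) lborel (\<lambda>x. \<Sum>j<p. v $ j * x j) (normal_density (v \<bullet> w) 1)"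
    using sumJ[of "\<lambda>j. w $ j"] sumJ[of "\<lambda>j. v $ j"] vv w
    by (simp add: sumJ power2_eq_square scalar_prod_def lessThan_atLeast0)
  have "distr (gauss_vec p w) borel (\<lambda>x. v \<bullet> Matrix.vec p x)
      = distr (PiM {..<p} M) lborel (\<lambda>x. \<Sum>j<p. v $ j * x j)"
    unfolding g by (intro distr_cong) (auto simp: scalar_prod_def lessThan_atLeast0)
  also have "\<dots> = density lborel (normal_density (v \<bullet> w) 1)"
    using D by (simp add: distributed_def)
  finally show ?thesis .
qed

section \<open>Deviation of the second moments on a fixed part\<close>

lemma measurable_scalar_prod_vec[measurable]:
  "(\<lambda>x. v \<bullet> Matrix.vec p x) \<in> borel_measurable (gauss_vec p w)"
proof -
  have "(\<lambda>x. v \<bullet> Matrix.vec p x) = (\<lambda>x. \<Sum>j<p. v $ j * x j)"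
    by (auto simp: scalar_prod_def lessThan_atLeast0)
  moreover have "(\<lambda>x. \<Sum>j<p. v $ j * x j) \<in> borel_measurable (gauss_vec p w)"
    unfolding gauss_vec_def by measurable
  ultimately show ?thesis by simp
qed

abbreviation gauss_sample :: "nat \<Rightarrow> nat \<Rightarrow> real Matrix.vec \<Rightarrow> (nat \<Rightarrow> real) \<Rightarrow> (nat \<Rightarrow> nat \<Rightarrow> real) measure" where
  "gauss_sample n p \<theta> z \<equiv> (\<Pi>\<^sub>M i\<in>{..<n}. gauss_vec p (z i \<cdot>\<^sub>v \<theta>))"

text \<open>The sign \<open>s\<close> selects the upper or the lower tail. The signs \<open>z i\<close> disappear because the squared
projection has a law that depends on the mean only through \<open>(v \<bullet> \<theta>)\<^sup>2\<close>. The bound is stated with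
some \<open>B\<close> above \<open>1 + |\<theta>|\<^sup>2\<close> so that one value can serve both \<open>\<theta>\<close> and \<open>\<eta>\<close>.\<close>

lemma projected_deviation_one_sided:
  assumes v: "v \<in> carrier_vec p" "v \<bullet> v = 1" and \<theta>: "\<theta> \<in> carrier_vec p"
    and z: "z \<in> sign_vectors n" and D: "D \<subseteq> {..<n}" and t: "0 \<le> t" "t \<le> 2"
    and B: "1 + \<theta> \<bullet> \<theta> \<le> B" and s: "\<bar>s\<bar> = 1"
  shows "emeasure (gauss_sample n p \<theta> z) {X \<in> space (gauss_sample n p \<theta> z).
      t * real (card D) \<le> s * (\<Sum>i\<in>D. (v \<bullet> Matrix.vec p (X i))\<^sup>2 - (v \<bullet> \<theta>)\<^sup>2 - 1)}
    \<le> ennreal (exp (- (real (card D) * t\<^sup>2 / (16 * B))))"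
proof (cases "t = 0")
  case True
  have "prob_space (gauss_sample n p \<theta> z)" by (intro prob_space_PiM prob_space_gauss_vec)
  then have "emeasure (gauss_sample n p \<theta> z) A \<le> 1" for A
    by (rule prob_space.measure_le_1)
  then show ?thesis using True by simp
next
  case False
  have B1: "B \<ge> 1" using B scalar_prod_self_nonneg[of \<theta>] by linarith
  \<comment> \<open>This \<open>l\<close> minimises \<open>4 l\<^sup>2 B - |l| t\<close>, the exponent contributed by one observation.\<close>
  define l where "l = s * (t / (8 * B))"
  have al: "\<bar>l\<bar> = t / (8 * B)" using s t B1 by (simp add: l_def abs_mult)
  have l4: "\<bar>l\<bar> \<le> 1/4" unfolding al using t B1 by (simp add: field_simps)
  have D': "finite D" using D finite_subset by blast
  define h where "h = (\<lambda>i x. if i \<in> D then l * ((v \<bullet> Matrix.vec p x)\<^sup>2 - (v \<bullet> \<theta>)\<^sup>2 - 1) else 0)"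
  define c where "c = (\<lambda>i. if i \<in> D then 4 * l\<^sup>2 * B else 0)"
  have bound: "emeasure (gauss_sample n p \<theta> z) {X \<in> space (gauss_sample n p \<theta> z). t / (8 * B) * (t * real (card D)) \<le> (\<Sum>i<n. h i (X i))}
     \<le> ennreal (exp ((\<Sum>i<n. c i) - t / (8 * B) * (t * real (card D))))"
  proof (rule product_chernoff_bound)
    show "prob_space (gauss_vec p (z i \<cdot>\<^sub>v \<theta>))" for i by (rule prob_space_gauss_vec)
    show "h i \<in> borel_measurable (gauss_vec p (z i \<cdot>\<^sub>v \<theta>))" for i
      unfolding h_def by (cases "i \<in> D") simp_all
    fix i assume i: "i \<in> {..<n}"
    let ?M = "gauss_vec p (z i \<cdot>\<^sub>v \<theta>)"
    show "(\<integral>\<^sup>+x. ennreal (exp (h i x)) \<partial>?M) \<le> ennreal (exp (c i))"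
    proof (cases "i \<in> D")
      case True
      have "z i = 1 \<or> z i = -1" using z i by (auto simp: sign_vectors_def PiE_iff)
      then have sq: "(v \<bullet> \<theta>)\<^sup>2 = (v \<bullet> (z i \<cdot>\<^sub>v \<theta>))\<^sup>2" using v \<theta> by auto
      have "(v \<bullet> \<theta>)\<^sup>2 \<le> \<theta> \<bullet> \<theta>" using scalar_prod_cauchy_schwarz[OF v(1) \<theta>] v(2) by simp
      then have le: "4 * l\<^sup>2 * (1 + (v \<bullet> (z i \<cdot>\<^sub>v \<theta>))\<^sup>2) \<le> 4 * l\<^sup>2 * B"
        unfolding sq[symmetric] using B by (intro mult_left_mono) auto
      have "(\<integral>\<^sup>+x. ennreal (exp (h i x)) \<partial>?M)
         = (\<integral>\<^sup>+y. ennreal (exp (l * (y\<^sup>2 - (v \<bullet> (z i \<cdot>\<^sub>v \<theta>))\<^sup>2 - 1))) \<partial>distr ?M borel (\<lambda>x. v \<bullet> Matrix.vec p x))"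
        using True by (subst nn_integral_distr) (auto simp: h_def sq)
      also have "\<dots> \<le> ennreal (exp (4 * l\<^sup>2 * (1 + (v \<bullet> (z i \<cdot>\<^sub>v \<theta>))\<^sup>2)))"
        using v \<theta> by (subst gauss_vec_unit_projection) (auto intro: centred_normal_square_mgf_le[OF l4])
      also have "\<dots> \<le> ennreal (exp (4 * l\<^sup>2 * B))" using le by (intro ennreal_leI) simp
      finally show ?thesis using True by (simp add: c_def)
    next
      case False
      then show ?thesis
        using prob_space.emeasure_space_1[OF prob_space_gauss_vec, of p "z i \<cdot>\<^sub>v \<theta>"] by (simp add: h_def c_def)
    qed
  qed simp
  have Dn: "{..<n} \<inter> D = D" using D by auto
  have sum_h: "(\<Sum>i<n. h i (X i)) = t / (8 * B) * (s * (\<Sum>i\<in>D. (v \<bullet> Matrix.vec p (X i))\<^sup>2 - (v \<bullet> \<theta>)\<^sup>2 - 1))" for X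
    unfolding h_def by (simp add: sum.If_cases Dn sum_distrib_left l_def mult_ac)
  have sum_c: "(\<Sum>i<n. c i) = real (card D) * (4 * l\<^sup>2 * B)"
    unfolding c_def by (simp add: sum.If_cases Dn)
  have set_eq: "t / (8 * B) * (t * real (card D)) \<le> t / (8 * B) * r \<longleftrightarrow> t * real (card D) \<le> r" for r
    using t False B1 by (intro mult_le_cancel_left_pos) simp
  have l2: "l\<^sup>2 = (t / (8 * B))\<^sup>2" using al by (metis power2_abs)
  have "real (card D) * (4 * l\<^sup>2 * B) - t / (8 * B) * (t * real (card D)) = - (real (card D) * t\<^sup>2 / (16 * B))"
    unfolding l2 using B1 by (simp add: field_simps power2_eq_square)
  then show ?thesis using bound unfolding sum_h sum_c set_eq by simp
qed

text \<open>Both sides of the inequality scale with the square of \<open>v\<close>, so the bound for unit vectors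
carries over to the grid, whose points have no common norm.\<close>

lemma projected_deviation_prob:
  assumes v: "v \<in> carrier_vec p" and \<theta>: "\<theta> \<in> carrier_vec p"
    and z: "z \<in> sign_vectors n" and D: "D \<subseteq> {..<n}" and t: "0 \<le> t" "t \<le> 2"
    and B: "1 + \<theta> \<bullet> \<theta> \<le> B"
  shows "emeasure (gauss_sample n p \<theta> z) {X \<in> space (gauss_sample n p \<theta> z).
      t * real (card D) * (v \<bullet> v) < \<bar>\<Sum>i\<in>D. (v \<bullet> Matrix.vec p (X i))\<^sup>2 - (v \<bullet> \<theta>)\<^sup>2 - v \<bullet> v\<bar>}
    \<le> ennreal (2 * exp (- (real (card D) * t\<^sup>2 / (16 * B))))"
proof (cases "v \<bullet> v = 0")
  case True
  then have 0: "(v \<bullet> w)\<^sup>2 = 0" if "w \<in> carrier_vec p" for w using scalar_prod_cauchy_schwarz[OF v that] by simp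
  show ?thesis unfolding True using 0[OF \<theta>] 0[OF vec_carrier] by simp
next
  case False
  define c where "c = 1 / sqrt (v \<bullet> v)"
  have c: "c\<^sup>2 * (v \<bullet> v) = 1" "c > 0" using False scalar_prod_self_nonneg[of v]
    by (auto simp: c_def field_simps)
  define u where "u = c \<cdot>\<^sub>v v"
  have u: "u \<in> carrier_vec p" "u \<bullet> u = 1" using v c by (auto simp: u_def power2_eq_square mult.assoc)
  let ?M = "gauss_sample n p \<theta> z"
  let ?S = "\<lambda>X. \<Sum>i\<in>D. (u \<bullet> Matrix.vec p (X i))\<^sup>2 - (u \<bullet> \<theta>)\<^sup>2 - 1"
  let ?A = "\<lambda>s. {X \<in> space ?M. t * real (card D) \<le> s * ?S X}"
  have S: "?S X = c\<^sup>2 * (\<Sum>i\<in>D. (v \<bullet> Matrix.vec p (X i))\<^sup>2 - (v \<bullet> \<theta>)\<^sup>2 - v \<bullet> v)" for X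
    unfolding sum_distrib_left u_def using v \<theta> c
    by (intro sum.cong refl) (simp add: power_mult_distrib right_diff_distrib smult_scalar_prod_distrib[OF v vec_carrier])
  have [measurable]: "(\<lambda>X. ?S X) \<in> borel_measurable ?M"
  proof -
    have [measurable]: "(\<lambda>X. u \<bullet> Matrix.vec p (X i)) \<in> borel_measurable ?M" if "i \<in> D" for i
      using D that by (intro measurable_compose[OF measurable_component_singleton[of i] measurable_scalar_prod_vec]) auto
    show ?thesis by measurable
  qed
  have "{X \<in> space ?M. t * real (card D) * (v \<bullet> v) < \<bar>\<Sum>i\<in>D. (v \<bullet> Matrix.vec p (X i))\<^sup>2 - (v \<bullet> \<theta>)\<^sup>2 - v \<bullet> v\<bar>}
      \<subseteq> ?A 1 \<union> ?A (-1)"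
  proof safe
    fix X assume lt: "t * real (card D) * (v \<bullet> v) < \<bar>\<Sum>i\<in>D. (v \<bullet> Matrix.vec p (X i))\<^sup>2 - (v \<bullet> \<theta>)\<^sup>2 - v \<bullet> v\<bar>"
      and n: "\<not> t * real (card D) \<le> - 1 * ?S X"
    have "c\<^sup>2 * (t * real (card D) * (v \<bullet> v)) < c\<^sup>2 * \<bar>\<Sum>i\<in>D. (v \<bullet> Matrix.vec p (X i))\<^sup>2 - (v \<bullet> \<theta>)\<^sup>2 - v \<bullet> v\<bar>"
      using lt c(2) by (intro mult_strict_left_mono) auto
    also have "\<dots> = \<bar>?S X\<bar>" unfolding S by (simp add: abs_mult)
    also have "c\<^sup>2 * (t * real (card D) * (v \<bullet> v)) = t * real (card D)" using c(1)
      by (metis mult.left_commute mult.right_neutral)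
    finally show "t * real (card D) \<le> 1 * ?S X" using n by linarith
  qed
  then have "emeasure ?M {X \<in> space ?M. t * real (card D) * (v \<bullet> v) < \<bar>\<Sum>i\<in>D. (v \<bullet> Matrix.vec p (X i))\<^sup>2 - (v \<bullet> \<theta>)\<^sup>2 - v \<bullet> v\<bar>}
      \<le> emeasure ?M (?A 1 \<union> ?A (-1))"
    by (intro emeasure_mono) measurable
  also have "\<dots> \<le> emeasure ?M (?A 1) + emeasure ?M (?A (-1))"
    by (intro emeasure_subadditive) measurable
  also have "\<dots> \<le> ennreal (exp (- (real (card D) * t\<^sup>2 / (16 * B)))) + ennreal (exp (- (real (card D) * t\<^sup>2 / (16 * B))))"
    by (intro add_mono projected_deviation_one_sided[OF u \<theta> z D t B]) auto
  also have "\<dots> = ennreal (2 * exp (- (real (card D) * t\<^sup>2 / (16 * B))))"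
    by (simp add: ennreal_plus[symmetric] del: ennreal_plus)
  finally show ?thesis .
qed

definition grid_deviation ::
    "nat \<Rightarrow> real Matrix.vec \<Rightarrow> real \<Rightarrow> nat set \<Rightarrow> (nat \<Rightarrow> nat \<Rightarrow> real) \<Rightarrow> (nat \<Rightarrow> int) \<Rightarrow> bool" where
  "grid_deviation p \<theta> t D X k \<longleftrightarrow> (let v = grid_vec p k in
     t * real (card D) * (v \<bullet> v) < \<bar>\<Sum>i\<in>D. (v \<bullet> Matrix.vec p (X i))\<^sup>2 - (v \<bullet> \<theta>)\<^sup>2 - v \<bullet> v\<bar>)"

text \<open>Control on the grid extends to the whole sphere at the cost of a factor 2, since the deviation
is the quadratic form of the symmetric matrix \<open>S - \<theta>\<theta>\<^sup>T - I\<close>; the perturbation bound then applies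
with \<open>\<epsilon> = 2t\<close>.\<close>

lemma sign_loss_le_of_no_grid_deviation:
  assumes est: "spectral_estimator p est" and p: "p > 0"
    and D: "finite D" "D \<noteq> {}" and \<theta>: "\<theta> \<in> carrier_vec p"
    and t: "0 < t" "4 * t \<le> \<theta> \<bullet> \<theta>"
    and dev: "\<And>k. k \<in> grid_index p \<Longrightarrow> \<not> grid_deviation p \<theta> t D X k"
  shows "sign_loss (est D (\<lambda>i\<in>D. Matrix.vec p (X i))) \<theta> \<le> sqrt (10 * t)"
proof -
  define x where "x = (\<lambda>i\<in>D. Matrix.vec p (X i))"
  have x: "x i \<in> carrier_vec p" if "i \<in> D" for i using that by (simp add: x_def)
  define S where "S = second_moment_mat p D x"
  have S: "S \<in> carrier_mat p p" "transpose_mat S = S"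
    unfolding S_def by (rule second_moment_mat_carrier second_moment_mat_symmetric)+
  \<comment> \<open>The matrix \<open>\<theta>\<theta>\<^sup>T\<close>, written as the second moment matrix of the one-point sample \<open>\<theta>\<close>.\<close>
  define T where "T = second_moment_mat p {0} (\<lambda>_. \<theta>)"
  have T: "T \<in> carrier_mat p p" "transpose_mat T = T"
    unfolding T_def by (rule second_moment_mat_carrier second_moment_mat_symmetric)+
  have Tform: "v \<bullet> (T *\<^sub>v v) = (v \<bullet> \<theta>)\<^sup>2" if "v \<in> carrier_vec p" for v
    unfolding T_def using that \<theta> by (subst second_moment_mat_form) auto
  define E where "E = S - T - 1\<^sub>m p"
  have E: "E \<in> carrier_mat p p" using S T by (auto simp: E_def)
  have Et: "transpose_mat E = E"
  proof -
    have "S - T \<in> carrier_mat p p" using T by auto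
    moreover have "transpose_mat (S - T) = S - T" using transpose_minus[OF S(1) T(1)] S T by simp
    ultimately show ?thesis using transpose_minus[of "S - T" p p "1\<^sub>m p"] by (simp add: E_def)
  qed
  have Eform: "v \<bullet> (E *\<^sub>v v) = v \<bullet> (S *\<^sub>v v) - (v \<bullet> \<theta>)\<^sup>2 - v \<bullet> v" if v: "v \<in> carrier_vec p" for v
  proof -
    have ST: "S - T \<in> carrier_mat p p" using T by auto
    have "E *\<^sub>v v = S *\<^sub>v v - T *\<^sub>v v - v"
      unfolding E_def minus_mult_distrib_mat_vec[OF ST one_carrier_mat v]
        minus_mult_distrib_mat_vec[OF S(1) T(1) v] using v by simp
    moreover have Sv: "S *\<^sub>v v \<in> carrier_vec p" and Tv: "T *\<^sub>v v \<in> carrier_vec p" using S T v by auto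
    moreover have "S *\<^sub>v v - T *\<^sub>v v \<in> carrier_vec p" using Sv Tv by simp
    ultimately show ?thesis
      using scalar_prod_minus_distrib[OF v _ v, of "S *\<^sub>v v - T *\<^sub>v v"] scalar_prod_minus_distrib[OF v Sv Tv]
      by (simp add: Tform[OF v])
  qed
  have m: "real (card D) > 0" using D by (simp add: card_gt_0_iff)
  have Esum: "v \<bullet> (E *\<^sub>v v) = (\<Sum>i\<in>D. (v \<bullet> Matrix.vec p (X i))\<^sup>2 - (v \<bullet> \<theta>)\<^sup>2 - v \<bullet> v) / real (card D)"
    if v: "v \<in> carrier_vec p" for v
  proof -
    have "(\<Sum>i\<in>D. (v \<bullet> x i)\<^sup>2) = (\<Sum>i\<in>D. (v \<bullet> Matrix.vec p (X i))\<^sup>2)"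
      by (intro sum.cong) (auto simp: x_def)
    then show ?thesis
      unfolding Eform[OF v] S_def using m
      by (simp add: second_moment_mat_form[OF v x] sum_subtractf field_simps)
  qed
  have net: "\<bar>u \<bullet> (E *\<^sub>v u)\<bar> \<le> 2 * t" if u: "u \<in> carrier_vec p" "u \<bullet> u \<le> 1" for u
  proof (rule quadratic_form_le_of_net[OF E Et, of "grid_vec p ` grid_index p"])
    show "\<exists>v\<in>grid_vec p ` grid_index p. (u - v) \<bullet> (u - v) \<le> 1 / 64"
      if "u \<in> carrier_vec p" "u \<bullet> u \<le> 1" for u
      using grid_vec_near[OF that p] by auto
    fix v assume "v \<in> grid_vec p ` grid_index p"
    then obtain k where k: "k \<in> grid_index p" "v = grid_vec p k" by auto
    then have v: "v \<in> carrier_vec p" by (simp add: grid_vec_carrier)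
    show "\<bar>v \<bullet> (E *\<^sub>v v)\<bar> \<le> t * (v \<bullet> v)"
      using dev[OF k(1)] m unfolding Esum[OF v] grid_deviation_def Let_def k(2)[symmetric]
      by (simp add: abs_divide divide_le_eq mult_ac not_less)
  qed (use t u in \<open>auto simp: grid_vec_carrier\<close>)
  have "sign_loss (est D x) \<theta> \<le> sqrt (5 * (2 * t))"
  proof (rule spectral_estimator_sign_loss[OF est D x \<theta>])
    fix v :: "real Matrix.vec" assume v: "v \<in> carrier_vec p" "v \<bullet> v = 1"
    then show "\<bar>v \<bullet> (second_moment_mat p D x *\<^sub>v v) - 1 - (v \<bullet> \<theta>)\<^sup>2\<bar> \<le> 2 * t"
      using net[OF v(1)] by (simp add: Eform[OF v(1)] S_def[symmetric] algebra_simps)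
  qed (use t in auto)
  then show ?thesis by (simp add: x_def)
qed

section \<open>The random split\<close>

lemma emeasure_pair_le_of_slices:
  assumes "prob_space M1" "prob_space M2" and A: "A \<in> sets (M1 \<Otimes>\<^sub>M M2)"
    and le: "\<And>y. y \<in> space M2 \<Longrightarrow> emeasure M1 ((\<lambda>x. (x, y)) -` A) \<le> c"
  shows "emeasure (M1 \<Otimes>\<^sub>M M2) A \<le> c"
proof -
  interpret M1: prob_space M1 by fact
  interpret M2: prob_space M2 by fact
  interpret pair_sigma_finite M1 M2 ..
  have "emeasure (M1 \<Otimes>\<^sub>M M2) A = (\<integral>\<^sup>+y. emeasure M1 ((\<lambda>x. (x, y)) -` A) \<partial>M2)"
    by (rule emeasure_pair_measure_alt2[OF A])
  also have "\<dots> \<le> (\<integral>\<^sup>+y. c \<partial>M2)" by (intro nn_integral_mono le)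
  also have "\<dots> = c" by (simp add: M2.emeasure_space_1)
  finally show ?thesis .
qed

lemma emeasure_pair_le_of_slices':
  assumes "prob_space M1" "prob_space M2" and A: "A \<in> sets (M1 \<Otimes>\<^sub>M M2)"
    and le: "\<And>x. x \<in> space M1 \<Longrightarrow> emeasure M2 (Pair x -` A) \<le> c"
  shows "emeasure (M1 \<Otimes>\<^sub>M M2) A \<le> c"
proof -
  interpret M1: prob_space M1 by fact
  interpret M2: prob_space M2 by fact
  have "emeasure (M1 \<Otimes>\<^sub>M M2) A = (\<integral>\<^sup>+x. emeasure M2 (Pair x -` A) \<partial>M1)"
    by (rule M2.emeasure_pair_measure_alt[OF A])
  also have "\<dots> \<le> (\<integral>\<^sup>+x. c \<partial>M1)" by (intro nn_integral_mono le)
  also have "\<dots> = c" by (simp add: M1.emeasure_space_1)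
  finally show ?thesis .
qed

abbreviation split_law :: "nat \<Rightarrow> nat \<Rightarrow> (nat \<Rightarrow> nat) measure" where
  "split_law k n \<equiv> (\<Pi>\<^sub>M i\<in>{..<n}. measure_pmf (pmf_of_set {..<k}))"

text \<open>Sums over the random index set become sums over \<open>{..<n}\<close> of functions of single coordinates
of \<open>d\<close>; this gives measurability and makes the size of a part a sum of independent variables.\<close>

lemma sum_part: "(\<Sum>i\<in>part n d m. f i) = (\<Sum>i<n. if d i = m then f i else (0::real))"
  by (auto simp: part_def sum.If_cases intro!: sum.cong)

lemma card_part: "real (card (part n d m)) = (\<Sum>i<n. if d i = m then 1 else 0)"
  using sum_part[of "\<lambda>_. 1" n d m] by simp

text \<open>A part has expected size at least \<open>n/3\<close>. The Chernoff bound is taken with the exponential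
moment of \<open>- ln 2\<close> times the size, for which each coordinate contributes the factor
\<open>1 - 1/(2k) \<le> 5/6\<close>.\<close>

lemma small_part_prob:
  assumes k: "0 < k" "k \<le> 3" and m: "m < k"
  shows "emeasure (split_law k n) {d \<in> space (split_law k n). 6 * card (part n d m) \<le> n}
    \<le> ennreal (exp (- (real n * (ln (6/5) - ln 2 / 6))))"
proof -
  define h where "h = (\<lambda>(i::nat) (x::nat). - ln 2 * (if x = m then 1 else 0 :: real))"
  have "emeasure (split_law k n) {d \<in> space (split_law k n). - ln 2 * (real n / 6) \<le> (\<Sum>i<n. h i (d i))}
     \<le> ennreal (exp ((\<Sum>i<n. ln (5/6)) - (- ln 2 * (real n / 6))))"
  proof (rule product_chernoff_bound)
    fix i :: nat
    have "(\<integral>\<^sup>+x. ennreal (exp (h i x)) \<partial>measure_pmf (pmf_of_set {..<k}))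
        = (\<Sum>x<k. ennreal (exp (h i x))) / of_nat k"
      using k by (subst nn_integral_pmf_of_set) auto
    also have "(\<Sum>x<k. ennreal (exp (h i x))) = ennreal (\<Sum>x<k. exp (h i x))" by (simp add: sum_ennreal)
    also have "(\<Sum>x<k. exp (h i x)) = (\<Sum>x<k. 1 - (if x = m then 1/2 else 0))"
      by (intro sum.cong refl) (auto simp: h_def exp_minus)
    also have "\<dots> = real k - 1/2" using m by (simp add: sum_subtractf)
    also have "ennreal (real k - 1/2) / of_nat k = ennreal ((real k - 1/2) / real k)"
      using k by (simp add: ennreal_of_nat_eq_real_of_nat divide_ennreal)
    also have "\<dots> \<le> ennreal (exp (ln (5/6)))"
      using k by (intro ennreal_leI) (simp add: field_simps)
    finally show "(\<integral>\<^sup>+x. ennreal (exp (h i x)) \<partial>measure_pmf (pmf_of_set {..<k})) \<le> ennreal (exp (ln (5/6)))" .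
  qed (auto intro: prob_space_measure_pmf)
  moreover have "(\<Sum>i<n. h i (d i)) = - ln 2 * real (card (part n d m))" for d
    by (simp only: h_def card_part sum_distrib_left)
  moreover have "- ln 2 * (real n / 6) \<le> - ln 2 * real c \<longleftrightarrow> 6 * c \<le> n" for c
  proof -
    have "- ln 2 * (real n / 6) \<le> - ln 2 * real c \<longleftrightarrow> real c \<le> real n / 6" by simp
    also have "\<dots> \<longleftrightarrow> 6 * c \<le> n" by linarith
    finally show ?thesis .
  qed
  moreover have "(\<Sum>i<n. ln (5/6)) - (- ln 2 * (real n / 6)) = - (real n * (ln (6/5) - ln 2 / 6))"
    by (simp add: ln_div algebra_simps)
  ultimately show ?thesis by simp
qed

section \<open>Failure probability for given dimensions\<close>

text \<open>The union bound over the grid for a part with more than \<open>n/6\<close> members, which turns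
\<open>16\<close> into \<open>96\<close> in the exponent.\<close>

definition grid_tail :: "nat \<Rightarrow> nat \<Rightarrow> real \<Rightarrow> real \<Rightarrow> real" where
  "grid_tail n p t B = real ((16 * p + 1) ^ p) * (2 * exp (- (real n * t\<^sup>2 / (96 * B))))"

lemma measurable_split_coordinate:
  "i < n \<Longrightarrow> (\<lambda>d. d i) \<in> measurable (split_law k n) (count_space UNIV)"
  by (rule measurable_compose[OF measurable_component_singleton[of i]]) (auto simp: measurable_def)

lemma sets_grid_deviation:
  assumes f: "f \<in> measurable N (gauss_sample n p \<theta> z)" and g: "g \<in> measurable N (split_law k n)"
  shows "{\<omega> \<in> space N. grid_deviation p \<theta> t (part n (g \<omega>) m) (f \<omega>) j} \<in> sets N"
proof -
  let ?v = "grid_vec p j"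
  have [measurable]: "(\<lambda>\<omega>. ?v \<bullet> Matrix.vec p (f \<omega> i)) \<in> borel_measurable N" if "i < n" for i
    using that by (intro measurable_compose[OF f] measurable_compose[OF measurable_component_singleton[of i] measurable_scalar_prod_vec]) auto
  have g'[measurable]: "(\<lambda>\<omega>. g \<omega> i) \<in> measurable N (count_space UNIV)" if "i < n" for i
    using measurable_compose[OF g measurable_split_coordinate[OF that]] .
  have eq: "(\<lambda>\<omega>. \<Sum>i\<in>part n (g \<omega>) m. (?v \<bullet> Matrix.vec p (f \<omega> i))\<^sup>2 - (?v \<bullet> \<theta>)\<^sup>2 - ?v \<bullet> ?v)
    = (\<lambda>\<omega>. \<Sum>i<n. if g \<omega> i = m then (?v \<bullet> Matrix.vec p (f \<omega> i))\<^sup>2 - (?v \<bullet> \<theta>)\<^sup>2 - ?v \<bullet> ?v else 0)"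
    by (simp only: sum_part)
  have [measurable]: "(\<lambda>\<omega>. \<Sum>i\<in>part n (g \<omega>) m. (?v \<bullet> Matrix.vec p (f \<omega> i))\<^sup>2 - (?v \<bullet> \<theta>)\<^sup>2 - ?v \<bullet> ?v) \<in> borel_measurable N"
    unfolding eq by measurable
  have [measurable]: "(\<lambda>\<omega>. real (card (part n (g \<omega>) m))) \<in> borel_measurable N"
    unfolding card_part by measurable
  show ?thesis unfolding grid_deviation_def Let_def by measurable
qed

lemma sets_large_part:
  assumes g: "g \<in> measurable N (split_law k n)"
  shows "{\<omega> \<in> space N. n < 6 * card (part n (g \<omega>) m)} \<in> sets N"
proof -
  have g'[measurable]: "(\<lambda>\<omega>. g \<omega> i) \<in> measurable N (count_space UNIV)" if "i < n" for i
    using measurable_compose[OF g measurable_split_coordinate[OF that]] .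
  have [measurable]: "(\<lambda>\<omega>. real (card (part n (g \<omega>) m))) \<in> borel_measurable N"
    unfolding card_part by measurable
  have "n < 6 * card (part n (g \<omega>) m) \<longleftrightarrow> real n < 6 * real (card (part n (g \<omega>) m))" for \<omega>
    by linarith
  then show ?thesis by simp
qed

lemma grid_deviation_prob:
  assumes \<theta>: "\<theta> \<in> carrier_vec p" and z: "z \<in> sign_vectors n"
    and D: "D \<subseteq> {..<n}" "n < 6 * card D" and t: "0 \<le> t" "t \<le> 2" and B: "1 + \<theta> \<bullet> \<theta> \<le> B"
  shows "emeasure (gauss_sample n p \<theta> z)
      {X \<in> space (gauss_sample n p \<theta> z). \<exists>j\<in>grid_index p. grid_deviation p \<theta> t D X j}
    \<le> ennreal (grid_tail n p t B)"
proof -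
  let ?M = "gauss_sample n p \<theta> z"
  let ?A = "\<lambda>j. {X \<in> space ?M. grid_deviation p \<theta> t D X j}"
  let ?e = "2 * exp (- (real (card D) * t\<^sup>2 / (16 * B)))"
  have B1: "B \<ge> 1" using B scalar_prod_self_nonneg[of \<theta>] by linarith
  have A: "?A j \<in> sets ?M" for j
  proof -
    let ?v = "grid_vec p j"
    have [measurable]: "(\<lambda>X. ?v \<bullet> Matrix.vec p (X i)) \<in> borel_measurable ?M" if "i \<in> D" for i
      using D that by (intro measurable_compose[OF measurable_component_singleton[of i] measurable_scalar_prod_vec]) auto
    show ?thesis unfolding grid_deviation_def Let_def by measurable
  qed
  have "{X \<in> space ?M. \<exists>j\<in>grid_index p. grid_deviation p \<theta> t D X j} = (\<Union>j\<in>grid_index p. ?A j)" by auto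
  also have "emeasure ?M \<dots> \<le> (\<Sum>j\<in>grid_index p. emeasure ?M (?A j))"
    using A by (intro emeasure_subadditive_finite finite_grid_index) auto
  also have "\<dots> \<le> (\<Sum>j\<in>grid_index p. ennreal ?e)"
    unfolding grid_deviation_def Let_def
    by (intro sum_mono projected_deviation_prob grid_vec_carrier \<theta> z D t B)
  also have "\<dots> = ennreal (real ((16 * p + 1) ^ p) * ?e)"
    by (simp add: card_grid_index ennreal_of_nat_eq_real_of_nat ennreal_mult[symmetric])
  also have "\<dots> \<le> ennreal (grid_tail n p t B)"
  proof -
    have "real n \<le> 6 * real (card D)" using D(2) by linarith
    then have "real n * t\<^sup>2 \<le> 6 * real (card D) * t\<^sup>2" by (intro mult_right_mono) auto
    then have "real n * t\<^sup>2 / (96 * B) \<le> real (card D) * t\<^sup>2 / (16 * B)"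
      using B1 by (simp add: field_simps)
    then show ?thesis unfolding grid_tail_def by (intro ennreal_leI mult_left_mono) auto
  qed
  finally show ?thesis .
qed

lemma prob_space_gauss_sample: "prob_space (gauss_sample n p \<theta> z)"
  by (intro prob_space_PiM prob_space_gauss_vec)

lemma prob_space_split_law: "prob_space (split_law k n)"
  by (intro prob_space_PiM prob_space_measure_pmf)

text \<open>For each label \<open>m\<close> the failure event is covered by three measurable events: the part is small
(\<open>S m\<close>), or it is large and the form deviates at a grid point for the first sample (\<open>U m\<close>) or for
the second (\<open>V m\<close>). Since the split is independent of the samples, each of the three is estimated
with the remaining components held fixed. The set \<open>J\<close> of labels is a parameter so that the same
bound serves both splitting schemes.\<close>

lemma outer_prob_loss_le:
  assumes k: "0 < k" "k \<le> 3" and J: "J \<subseteq> {..<k}"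
    and p: "p > 0" and q: "q > 0" and \<theta>: "\<theta> \<in> carrier_vec p" and \<eta>: "\<eta> \<in> carrier_vec q"
    and z: "z \<in> sign_vectors n" and \<sigma>: "\<sigma> \<in> sign_vectors n"
    and t: "0 < t" "t \<le> 2" "4 * t \<le> \<theta> \<bullet> \<theta>" "4 * t \<le> \<eta> \<bullet> \<eta>"
    and B: "1 + \<theta> \<bullet> \<theta> \<le> B" "1 + \<eta> \<bullet> \<eta> \<le> B"
    and est: "spectral_estimator p \<theta>hat" "spectral_estimator q \<eta>hat"
    and A: "\<And>X Y d. A X Y d \<Longrightarrow> \<exists>m\<in>J. sqrt (10 * t) < sign_loss (est_on_part n p \<theta>hat X d m) \<theta>
       \<or> sqrt (10 * t) < sign_loss (est_on_part n q \<eta>hat Y d m) \<eta>"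
  shows "outer_measure_of (model k n p q \<theta> \<eta> z \<sigma>)
      {(X, Y, d). (X, Y, d) \<in> space (model k n p q \<theta> \<eta> z \<sigma>) \<and> A X Y d}
    \<le> ennreal (3 * (exp (- (real n * (ln (6/5) - ln 2 / 6))) + grid_tail n p t B + grid_tail n q t B))"
proof -
  let ?X = "gauss_sample n p \<theta> z" and ?Y = "gauss_sample n q \<eta> \<sigma>" and ?d = "split_law k n"
  let ?M = "?X \<Otimes>\<^sub>M (?Y \<Otimes>\<^sub>M ?d)"
  have model: "model k n p q \<theta> \<eta> z \<sigma> = ?M" by (simp add: model_def)
  have PX: "prob_space ?X" and PY: "prob_space ?Y" by (rule prob_space_gauss_sample)+
  have Pd: "prob_space ?d" by (rule prob_space_split_law)
  have PYd: "prob_space (?Y \<Otimes>\<^sub>M ?d)" by (intro prob_space_pair PY Pd)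
  define S where "S = (\<lambda>m. {w \<in> space ?M. \<not> n < 6 * card (part n (snd (snd w)) m)})"
  define U where "U = (\<lambda>m. {w \<in> space ?M. n < 6 * card (part n (snd (snd w)) m)
      \<and> (\<exists>j\<in>grid_index p. grid_deviation p \<theta> t (part n (snd (snd w)) m) (fst w) j)})"
  define V where "V = (\<lambda>m. {w \<in> space ?M. n < 6 * card (part n (snd (snd w)) m)
      \<and> (\<exists>j\<in>grid_index q. grid_deviation q \<eta> t (part n (snd (snd w)) m) (fst (snd w)) j)})"
  have part: "part n d m \<subseteq> {..<n}" "finite (part n d m)" for d m by (auto simp: part_def)
  have Sm: "S m \<in> sets ?M" for m
    unfolding S_def by (intro sets.sets_Collect_neg sets_large_part[where k=k]) measurable
  have Um: "U m \<in> sets ?M" for m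
    unfolding U_def
    by (intro sets.sets_Collect_conj sets_large_part[where k=k] sets.sets_Collect_finite_Ex
        sets_grid_deviation[where z=z and k=k] finite_grid_index) measurable
  have Vm: "V m \<in> sets ?M" for m
    unfolding V_def
    by (intro sets.sets_Collect_conj sets_large_part[where k=k] sets.sets_Collect_finite_Ex
        sets_grid_deviation[where z=\<sigma> and k=k] finite_grid_index) measurable
  have Vin: "{w \<in> space (?Y \<Otimes>\<^sub>M ?d). n < 6 * card (part n (snd w) m)
      \<and> (\<exists>j\<in>grid_index q. grid_deviation q \<eta> t (part n (snd w) m) (fst w) j)} \<in> sets (?Y \<Otimes>\<^sub>M ?d)" for m
    by (intro sets.sets_Collect_conj sets_large_part[where k=k] sets.sets_Collect_finite_Ex
        sets_grid_deviation[where z=\<sigma> and k=k] finite_grid_index) measurable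
  have Sin: "{d \<in> space ?d. 6 * card (part n d m) \<le> n} \<in> sets ?d" for m
  proof -
    have "{d \<in> space ?d. \<not> n < 6 * card (part n d m)} \<in> sets ?d"
      by (intro sets.sets_Collect_neg sets_large_part[where k=k]) measurable
    then show ?thesis by (simp add: not_less)
  qed
  have S_le: "emeasure ?M (S m) \<le> ennreal (exp (- (real n * (ln (6/5) - ln 2 / 6))))" if m: "m < k" for m
  proof (rule emeasure_pair_le_of_slices'[OF PX PYd Sm])
    fix X assume X: "X \<in> space ?X"
    have "Pair X -` S m = space ?Y \<times> {d \<in> space ?d. 6 * card (part n d m) \<le> n}"
      using X by (auto simp: S_def space_pair_measure)
    moreover have "space ?Y \<times> {d \<in> space ?d. 6 * card (part n d m) \<le> n} \<in> sets (?Y \<Otimes>\<^sub>M ?d)"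
      using Sin by (intro pair_measureI) auto
    moreover have "emeasure (?Y \<Otimes>\<^sub>M ?d) (space ?Y \<times> {d \<in> space ?d. 6 * card (part n d m) \<le> n})
        \<le> ennreal (exp (- (real n * (ln (6/5) - ln 2 / 6))))"
    proof (rule emeasure_pair_le_of_slices'[OF PY Pd])
      fix Y assume "Y \<in> space ?Y"
      then show "emeasure ?d (Pair Y -` (space ?Y \<times> {d \<in> space ?d. 6 * card (part n d m) \<le> n}))
        \<le> ennreal (exp (- (real n * (ln (6/5) - ln 2 / 6))))"
        using small_part_prob[OF k m] by simp
    qed fact
    ultimately show "emeasure (?Y \<Otimes>\<^sub>M ?d) (Pair X -` S m) \<le> ennreal (exp (- (real n * (ln (6/5) - ln 2 / 6))))"
      by simp
  qed
  have U_le: "emeasure ?M (U m) \<le> ennreal (grid_tail n p t B)" for m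
  proof (rule emeasure_pair_le_of_slices[OF PX PYd Um])
    fix w assume w: "w \<in> space (?Y \<Otimes>\<^sub>M ?d)"
    let ?D = "part n (snd w) m"
    show "emeasure ?X ((\<lambda>x. (x, w)) -` U m) \<le> ennreal (grid_tail n p t B)"
    proof (cases "n < 6 * card ?D")
      case True
      then have "(\<lambda>x. (x, w)) -` U m = {X \<in> space ?X. \<exists>j\<in>grid_index p. grid_deviation p \<theta> t ?D X j}"
        using w by (auto simp: U_def space_pair_measure)
      then show ?thesis
        using grid_deviation_prob[OF \<theta> z part(1) True _ t(2) B(1)] t(1) by simp
    next
      case False
      then have "(\<lambda>x. (x, w)) -` U m = {}" by (auto simp: U_def)
      then show ?thesis by simp
    qed
  qed
  have V_le: "emeasure ?M (V m) \<le> ennreal (grid_tail n q t B)" for m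
  proof (rule emeasure_pair_le_of_slices'[OF PX PYd Vm])
    fix X assume X: "X \<in> space ?X"
    have eq: "Pair X -` V m = {w \<in> space (?Y \<Otimes>\<^sub>M ?d). n < 6 * card (part n (snd w) m)
      \<and> (\<exists>j\<in>grid_index q. grid_deviation q \<eta> t (part n (snd w) m) (fst w) j)}"
      using X by (auto simp: V_def space_pair_measure)
    show "emeasure (?Y \<Otimes>\<^sub>M ?d) (Pair X -` V m) \<le> ennreal (grid_tail n q t B)"
      unfolding eq
    proof (rule emeasure_pair_le_of_slices[OF PY Pd Vin])
      fix d assume d: "d \<in> space ?d"
      let ?D = "part n d m"
      show "emeasure ?Y ((\<lambda>y. (y, d)) -` {w \<in> space (?Y \<Otimes>\<^sub>M ?d). n < 6 * card (part n (snd w) m)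
        \<and> (\<exists>j\<in>grid_index q. grid_deviation q \<eta> t (part n (snd w) m) (fst w) j)}) \<le> ennreal (grid_tail n q t B)"
        (is "emeasure ?Y ?W \<le> _")
      proof (cases "n < 6 * card ?D")
        case True
        then have "?W = {Y \<in> space ?Y. \<exists>j\<in>grid_index q. grid_deviation q \<eta> t ?D Y j}"
          using d by (auto simp: space_pair_measure)
        then show ?thesis
          using grid_deviation_prob[OF \<eta> \<sigma> part(1) True _ t(2) B(2)] t(1) by simp
      next
        case False
        then have W: "?W = {}" by auto
        show ?thesis unfolding W by simp
      qed
    qed
  qed
  let ?b = "exp (- (real n * (ln (6/5) - ln 2 / 6))) + grid_tail n p t B + grid_tail n q t B"
  have g0: "0 \<le> grid_tail n p t B" "0 \<le> grid_tail n q t B" by (simp_all add: grid_tail_def)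
  have m_le: "emeasure ?M (S m \<union> (U m \<union> V m)) \<le> ennreal ?b" if "m < k" for m
  proof -
    have "emeasure ?M (S m \<union> (U m \<union> V m)) \<le> emeasure ?M (S m) + emeasure ?M (U m \<union> V m)"
      using Sm Um Vm by (intro emeasure_subadditive) auto
    also have "\<dots> \<le> emeasure ?M (S m) + (emeasure ?M (U m) + emeasure ?M (V m))"
      using Um Vm by (intro add_left_mono emeasure_subadditive)
    also have "\<dots> \<le> ennreal (exp (- (real n * (ln (6/5) - ln 2 / 6)))) + (ennreal (grid_tail n p t B) + ennreal (grid_tail n q t B))"
      using that by (intro add_mono S_le U_le V_le)
    also have "\<dots> = ennreal ?b" using g0 by (simp add: ennreal_plus[symmetric] add.assoc del: ennreal_plus)
    finally show ?thesis .
  qed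
  define C where "C = (\<Union>m<k. S m \<union> (U m \<union> V m))"
  have C: "C \<in> sets ?M" unfolding C_def using Sm Um Vm by auto
  have sub: "{(X, Y, d). (X, Y, d) \<in> space ?M \<and> A X Y d} \<subseteq> C"
  proof safe
    fix X Y d assume w: "(X, Y, d) \<in> space ?M" and "A X Y d"
    then obtain m where m: "m \<in> J" and or: "sqrt (10 * t) < sign_loss (est_on_part n p \<theta>hat X d m) \<theta>
       \<or> sqrt (10 * t) < sign_loss (est_on_part n q \<eta>hat Y d m) \<eta>" using A by blast
    let ?D = "part n d m"
    have "(X, Y, d) \<in> S m \<union> (U m \<union> V m)"
    proof (rule ccontr)
      assume no: "(X, Y, d) \<notin> S m \<union> (U m \<union> V m)"
      have large: "n < 6 * card ?D" using no w by (simp add: S_def)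
      then have D: "?D \<noteq> {}" by auto
      have "sign_loss (est_on_part n p \<theta>hat X d m) \<theta> \<le> sqrt (10 * t)"
        unfolding est_on_part_def
        by (rule sign_loss_le_of_no_grid_deviation[OF est(1) p part(2) D \<theta> t(1,3)])
           (use no w large in \<open>auto simp: U_def\<close>)
      moreover have "sign_loss (est_on_part n q \<eta>hat Y d m) \<eta> \<le> sqrt (10 * t)"
        unfolding est_on_part_def
        by (rule sign_loss_le_of_no_grid_deviation[OF est(2) q part(2) D \<eta> t(1,4)])
           (use no w large in \<open>auto simp: V_def\<close>)
      ultimately show False using or by linarith
    qed
    then show "(X, Y, d) \<in> C" using m J unfolding C_def by blast
  qed
  have "outer_measure_of ?M {(X, Y, d). (X, Y, d) \<in> space ?M \<and> A X Y d} \<le> emeasure ?M C"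
    unfolding outer_measure_of_def using C sub by (intro INF_lower) auto
  also have "\<dots> \<le> (\<Sum>m<k. emeasure ?M (S m \<union> (U m \<union> V m)))"
    unfolding C_def using Sm Um Vm by (intro emeasure_subadditive_finite) auto
  also have "\<dots> \<le> (\<Sum>m<k. ennreal ?b)" by (intro sum_mono m_le) auto
  also have "\<dots> = ennreal (real k * ?b)"
    using g0 by (simp add: ennreal_of_nat_eq_real_of_nat ennreal_mult[symmetric] del: ennreal_plus)
  also have "\<dots> \<le> ennreal (3 * ?b)"
    using k g0 by (intro ennreal_leI mult_right_mono) auto
  finally show ?thesis unfolding model .
qed

section \<open>Signal strength and rates\<close>

text \<open>The two given quantities are the legs of a right triangle with hypotenuse \<open>sqrt (a\<^sup>2 + b\<^sup>2)\<close>, by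
\<open>(2ab)\<^sup>2 + (a\<^sup>2 - b\<^sup>2)\<^sup>2 = (a\<^sup>2 + b\<^sup>2)\<^sup>2\<close>. This fixes \<open>a\<^sup>2 + b\<^sup>2 = 2 (r + s) L\<close>, and the first leg is at most
\<open>2 min a b\<close>.\<close>

lemma norms_of_signal_strength:
  fixes a b :: real
  assumes L: "L > 0" and r: "r > 0" and s: "s \<ge> 0" and a: "a \<ge> 0" and b: "b \<ge> 0"
    and 1: "2 * a * b / sqrt (a\<^sup>2 + b\<^sup>2) = sqrt (2 * r * L)"
    and 2: "\<bar>a\<^sup>2 - b\<^sup>2\<bar> / sqrt (a\<^sup>2 + b\<^sup>2) = sqrt (2 * s * L)"
  shows "a\<^sup>2 \<le> 2 * (r + s) * L" "b\<^sup>2 \<le> 2 * (r + s) * L" "r * L / 2 \<le> a\<^sup>2" "r * L / 2 \<le> b\<^sup>2"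
proof -
  define N where "N = a\<^sup>2 + b\<^sup>2"
  have "N \<noteq> 0" using 1 L r by (auto simp: N_def)
  then have N: "N > 0" by (metis N_def less_eq_real_def sum_power2_ge_zero)
  have "(2 * a * b / sqrt N)\<^sup>2 = 2 * r * L" using 1 L r by (simp add: N_def)
  then have e1: "4 * (a\<^sup>2 * b\<^sup>2) = 2 * r * L * N"
    using N by (simp add: power_divide field_simps power_mult_distrib)
  have "(\<bar>a\<^sup>2 - b\<^sup>2\<bar> / sqrt N)\<^sup>2 = 2 * s * L" using 2 L s by (simp add: N_def)
  then have e2: "(a\<^sup>2 - b\<^sup>2)\<^sup>2 = 2 * s * L * N"
    using N by (simp add: power_divide field_simps)
  have "N * N = 4 * (a\<^sup>2 * b\<^sup>2) + (a\<^sup>2 - b\<^sup>2)\<^sup>2" by (simp add: N_def power2_eq_square algebra_simps)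
  also have "\<dots> = (2 * (r + s) * L) * N" unfolding e1 e2 by (simp add: algebra_simps)
  finally have NN: "N = 2 * (r + s) * L" using N by simp
  show "a\<^sup>2 \<le> 2 * (r + s) * L" "b\<^sup>2 \<le> 2 * (r + s) * L" unfolding NN[symmetric] by (simp_all add: N_def)
  have "a\<^sup>2 * b\<^sup>2 \<le> a\<^sup>2 * N" "a\<^sup>2 * b\<^sup>2 \<le> b\<^sup>2 * N" by (simp_all add: N_def mult_left_mono algebra_simps)
  moreover have "(r * L / 2) * N = a\<^sup>2 * b\<^sup>2" using e1 by (simp add: algebra_simps)
  ultimately have "(r * L / 2) * N \<le> a\<^sup>2 * N" "(r * L / 2) * N \<le> b\<^sup>2 * N" by simp_all
  then show "r * L / 2 \<le> a\<^sup>2" "r * L / 2 \<le> b\<^sup>2" using N by simp_all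
qed

lemma grid_tail_le:
  assumes n: "n \<ge> 1" and p: "real p \<le> real n powr (1 - \<delta>)" and d: "0 \<le> \<delta>"
  shows "grid_tail n p t B \<le> 2 * exp (real n powr (1 - \<delta>) * ln (16 * real n + 1) - real n * t\<^sup>2 / (96 * B))"
proof -
  have "real n powr (1 - \<delta>) \<le> real n powr 1" using n d by (intro powr_mono) auto
  then have pn: "real p \<le> real n" using p n by simp
  have "real ((16 * p + 1) ^ p) = exp (real p * ln (16 * real p + 1))"
    by (simp add: exp_of_nat_mult add.commute)
  also have "\<dots> \<le> exp (real n powr (1 - \<delta>) * ln (16 * real n + 1))"
    using p pn by (intro iffD2[OF exp_le_cancel_iff] mult_mono) auto
  finally show ?thesis
    unfolding grid_tail_def exp_diff exp_minus by (simp add: field_simps mult_right_mono divide_right_mono)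
qed

text \<open>The exponent \<open>n powr (1 - \<delta>) * log n\<close> of the grid is dominated by
\<open>n powr (1 - \<delta>/4) / log n\<close>.\<close>

lemma tail_tendsto_0:
  fixes \<delta> K :: real
  assumes "0 < \<delta>" "\<delta> < 1" "0 < K"
  shows "(\<lambda>n::nat. exp (real n powr (1 - \<delta>) * ln (16 * real n + 1)
      - real n * (real n powr (- (\<delta> / 8)))\<^sup>2 / (96 * (1 + K * ln (real n))))) \<longlonglongrightarrow> 0"
  using assms by real_asymp

lemma eventually_small:
  fixes \<delta> r :: real
  assumes "0 < \<delta>" "0 < r"
  shows "eventually (\<lambda>n::nat. 4 * real n powr (- (\<delta> / 8)) \<le> r * ln (real n) / 2) sequentially"
    "eventually (\<lambda>n::nat. 10 * real n powr (- (\<delta> / 8)) \<le> real n powr (- (\<delta> / 16))) sequentially"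
  using assms by real_asymp+

text \<open>The exponential rate in \<open>small_part_prob\<close> is a genuine one.\<close>

lemma split_rate_pos: "ln (6/5) - ln 2 / 6 > (0::real)"
proof -
  have "ln 2 < ln ((6/5::real) ^ 6)" by (subst ln_less_cancel_iff) (auto simp: power_numeral_reduce)
  then show ?thesis by (simp add: ln_realpow)
qed

theorem corollary5p1:
  fixes \<delta> :: real
  assumes "0 < \<delta>" "\<delta> < 1"
  shows "\<exists>\<gamma>>0. \<forall>(r::real) (s::real) (p::nat \<Rightarrow> nat) (q::nat \<Rightarrow> nat)
      (\<theta>::nat \<Rightarrow> real Matrix.vec) (\<eta>::nat \<Rightarrow> real Matrix.vec)
      (\<theta>hat::nat \<Rightarrow> nat set \<Rightarrow> (nat \<Rightarrow> real Matrix.vec) \<Rightarrow> real Matrix.vec)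
      (\<eta>hat::nat \<Rightarrow> nat set \<Rightarrow> (nat \<Rightarrow> real Matrix.vec) \<Rightarrow> real Matrix.vec).
    r > 0 \<longrightarrow> s \<ge> 0 \<longrightarrow>
    (\<forall>n\<ge>2. \<theta> n \<in> carrier_vec (p n) \<and> \<eta> n \<in> carrier_vec (q n)) \<longrightarrow>
    (\<forall>n\<ge>2. 2 * l2_norm (\<theta> n) * l2_norm (\<eta> n) / sqrt ((l2_norm (\<theta> n))^2 + (l2_norm (\<eta> n))^2)
             = sqrt (2 * r * ln (real n))) \<longrightarrow>
    (\<forall>n\<ge>2. \<bar>(l2_norm (\<theta> n))^2 - (l2_norm (\<eta> n))^2\<bar> / sqrt ((l2_norm (\<theta> n))^2 + (l2_norm (\<eta> n))^2)
             = sqrt (2 * s * ln (real n))) \<longrightarrow>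
    (\<forall>n\<ge>2. real (max (p n) (q n)) < real n powr (1 - \<delta>)) \<longrightarrow>
    (\<forall>n\<ge>2. spectral_estimator (p n) (\<theta>hat n) \<and> spectral_estimator (q n) (\<eta>hat n)) \<longrightarrow>
    ((\<lambda>n. worst_case_prob 2 n (p n) (q n) (\<theta> n) (\<eta> n) (\<lambda>X Y d.
        max (max (sign_loss (est_on_part n (p n) (\<theta>hat n) X d 0) (\<theta> n))
                 (sign_loss (est_on_part n (p n) (\<theta>hat n) X d 1) (\<theta> n)))
            (max (sign_loss (est_on_part n (q n) (\<eta>hat n) Y d 0) (\<eta> n))
                 (sign_loss (est_on_part n (q n) (\<eta>hat n) Y d 1) (\<eta> n)))
        > real n powr (- \<gamma>))) \<longlonglongrightarrow> 0) \<and>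
    ((\<lambda>n. worst_case_prob 3 n (p n) (q n) (\<theta> n) (\<eta> n) (\<lambda>X Y d.
        max (sign_loss (est_on_part n (p n) (\<theta>hat n) X d 0) (\<theta> n))
            (sign_loss (est_on_part n (q n) (\<eta>hat n) Y d 0) (\<eta> n))
        > real n powr (- \<gamma>))) \<longlonglongrightarrow> 0)"
proof (intro exI[of _ "\<delta> / 32"] conjI allI impI)
  show "0 < \<delta> / 32" using assms by simp
  fix r s :: real and p q :: "nat \<Rightarrow> nat" and \<theta> \<eta> :: "nat \<Rightarrow> real Matrix.vec"
    and \<theta>hat \<eta>hat :: "nat \<Rightarrow> nat set \<Rightarrow> (nat \<Rightarrow> real Matrix.vec) \<Rightarrow> real Matrix.vec"
  assume r: "r > 0" and s: "s \<ge> 0"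
    and carrier: "\<forall>n\<ge>2. \<theta> n \<in> carrier_vec (p n) \<and> \<eta> n \<in> carrier_vec (q n)"
    and sum: "\<forall>n\<ge>2. 2 * l2_norm (\<theta> n) * l2_norm (\<eta> n) / sqrt ((l2_norm (\<theta> n))^2 + (l2_norm (\<eta> n))^2)
             = sqrt (2 * r * ln (real n))"
    and diff: "\<forall>n\<ge>2. \<bar>(l2_norm (\<theta> n))^2 - (l2_norm (\<eta> n))^2\<bar> / sqrt ((l2_norm (\<theta> n))^2 + (l2_norm (\<eta> n))^2)
             = sqrt (2 * s * ln (real n))"
    and dim: "\<forall>n\<ge>2. real (max (p n) (q n)) < real n powr (1 - \<delta>)"
    and est: "\<forall>n\<ge>2. spectral_estimator (p n) (\<theta>hat n) \<and> spectral_estimator (q n) (\<eta>hat n)"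
  define K where "K = 2 * (r + s)"
  define t where "t = (\<lambda>n::nat. real n powr (- (\<delta> / 8)))"
  define H where "H = (\<lambda>n::nat. exp (real n powr (1 - \<delta>) * ln (16 * real n + 1)
      - real n * (t n)\<^sup>2 / (96 * (1 + K * ln (real n)))))"
  define G where "G = (\<lambda>n::nat. 3 * (exp (- (real n * (ln (6/5) - ln 2 / 6))) + 2 * H n + 2 * H n))"
  have "H \<longlonglongrightarrow> 0" unfolding H_def t_def
    using assms r s by (intro tail_tendsto_0) (auto simp: K_def)
  moreover have "(\<lambda>n::nat. exp (- (real n * (ln (6/5) - ln 2 / 6)))) \<longlonglongrightarrow> 0"
    using split_rate_pos by real_asymp
  ultimately have "G \<longlonglongrightarrow> 3 * (0 + 2 * 0 + 2 * 0)" unfolding G_def by (intro tendsto_intros)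
  then have G: "(\<lambda>n. ennreal (G n)) \<longlonglongrightarrow> 0"
    using tendsto_ennrealI by fastforce
  \<comment> \<open>The event \<open>A n\<close> and the labels \<open>J\<close> are left open to treat the two splits at once.\<close>
  have bound: "eventually (\<lambda>n. worst_case_prob k n (p n) (q n) (\<theta> n) (\<eta> n) (A n) \<le> ennreal (G n)) sequentially"
    if k: "0 < k" "k \<le> 3" and J: "J \<subseteq> {..<k}"
      and A: "\<And>n X Y d. A n X Y d \<Longrightarrow> \<exists>m\<in>J. real n powr (- (\<delta> / 32)) < sign_loss (est_on_part n (p n) (\<theta>hat n) X d m) (\<theta> n)
       \<or> real n powr (- (\<delta> / 32)) < sign_loss (est_on_part n (q n) (\<eta>hat n) Y d m) (\<eta> n)"
    for k J A
  proof -
    have "eventually (\<lambda>n. 4 * t n \<le> r * ln (real n) / 2) sequentially"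
      "eventually (\<lambda>n::nat. 10 * t n \<le> real n powr (- (\<delta> / 16))) sequentially"
      unfolding t_def by (rule eventually_small[OF assms(1) r])+
    then show ?thesis using eventually_ge_at_top[of "2::nat"]
    proof eventually_elim
      case (elim n)
      have n: "n \<ge> 2" by fact
      have L: "ln (real n) > 0" using n by simp
      have sq: "(l2_norm v)\<^sup>2 = v \<bullet> v" "l2_norm v \<ge> 0" for v
        by (simp_all add: l2_norm_def scalar_prod_self_nonneg)
      note norms = norms_of_signal_strength[OF L r s sq(2) sq(2) sum[rule_format, OF n] diff[rule_format, OF n],
          unfolded sq(1)]
      have tn: "0 < t n" using n by (simp add: t_def)
      have t2: "t n \<le> 2"
      proof -
        have "t n \<le> real n powr 0" unfolding t_def using n assms by (intro powr_mono) auto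
        then show ?thesis using n by simp
      qed
      have th: "\<theta> n \<in> carrier_vec (p n)" and et: "\<eta> n \<in> carrier_vec (q n)" using carrier n by auto
      have t4: "4 * t n \<le> \<theta> n \<bullet> \<theta> n" "4 * t n \<le> \<eta> n \<bullet> \<eta> n" using elim(1) norms by linarith+
      have p: "p n > 0" and q: "q n > 0"
        using t4 tn th et by (auto simp: scalar_prod_def intro!: Nat.gr0I)
      have B: "1 + \<theta> n \<bullet> \<theta> n \<le> 1 + K * ln (real n)" "1 + \<eta> n \<bullet> \<eta> n \<le> 1 + K * ln (real n)"
        using norms by (simp_all add: K_def)
      have "sqrt (10 * t n) \<le> sqrt (real n powr (- (\<delta> / 16)))" using elim(2) by simp
      also have "\<dots> = real n powr (- (\<delta> / 32))"
        using n by (simp add: powr_half_sqrt[symmetric] powr_powr)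
      finally have loss: "sqrt (10 * t n) \<le> real n powr (- (\<delta> / 32))" .
      have tails: "grid_tail n (p n) (t n) (1 + K * ln (real n)) \<le> 2 * H n"
        "grid_tail n (q n) (t n) (1 + K * ln (real n)) \<le> 2 * H n"
        unfolding H_def using dim[rule_format, OF n] n assms by (intro grid_tail_le; simp)+
      show ?case unfolding worst_case_prob_def
      proof (intro SUP_least)
        fix z \<sigma> assume z: "z \<in> sign_vectors n" and \<sigma>: "\<sigma> \<in> sign_vectors n"
        have "outer_measure_of (model k n (p n) (q n) (\<theta> n) (\<eta> n) z \<sigma>)
            {(X, Y, d). (X, Y, d) \<in> space (model k n (p n) (q n) (\<theta> n) (\<eta> n) z \<sigma>) \<and> A n X Y d}
          \<le> ennreal (3 * (exp (- (real n * (ln (6/5) - ln 2 / 6))) + grid_tail n (p n) (t n) (1 + K * ln (real n))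
            + grid_tail n (q n) (t n) (1 + K * ln (real n))))"
        proof (rule outer_prob_loss_le[OF k J p q th et z \<sigma> tn t2 t4 B])
          show "spectral_estimator (p n) (\<theta>hat n)" "spectral_estimator (q n) (\<eta>hat n)"
            using est n by auto
          fix X Y d assume "A n X Y d"
          with A loss show "\<exists>m\<in>J. sqrt (10 * t n) < sign_loss (est_on_part n (p n) (\<theta>hat n) X d m) (\<theta> n)
            \<or> sqrt (10 * t n) < sign_loss (est_on_part n (q n) (\<eta>hat n) Y d m) (\<eta> n)"
            by (meson order_le_less_trans)
        qed
        also have "\<dots> \<le> ennreal (G n)"
          unfolding G_def using tails by (intro ennreal_leI mult_left_mono add_mono) auto
        finally show "outer_measure_of (model k n (p n) (q n) (\<theta> n) (\<eta> n) z \<sigma>)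
            {(X, Y, d). (X, Y, d) \<in> space (model k n (p n) (q n) (\<theta> n) (\<eta> n) z \<sigma>) \<and> A n X Y d} \<le> ennreal (G n)" .
      qed
    qed
  qed
  have lim: "(\<lambda>n. worst_case_prob k n (p n) (q n) (\<theta> n) (\<eta> n) (A n)) \<longlonglongrightarrow> 0"
    if "0 < k" "k \<le> 3" "J \<subseteq> {..<k}"
      "\<And>n X Y d. A n X Y d \<Longrightarrow> \<exists>m\<in>J. real n powr (- (\<delta> / 32)) < sign_loss (est_on_part n (p n) (\<theta>hat n) X d m) (\<theta> n)
       \<or> real n powr (- (\<delta> / 32)) < sign_loss (est_on_part n (q n) (\<eta>hat n) Y d m) (\<eta> n)"
    for k J A
    by (rule tendsto_sandwich[OF _ bound[OF that] tendsto_const G]) simp_all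
  show "(\<lambda>n. worst_case_prob 2 n (p n) (q n) (\<theta> n) (\<eta> n) (\<lambda>X Y d.
        max (max (sign_loss (est_on_part n (p n) (\<theta>hat n) X d 0) (\<theta> n))
                 (sign_loss (est_on_part n (p n) (\<theta>hat n) X d 1) (\<theta> n)))
            (max (sign_loss (est_on_part n (q n) (\<eta>hat n) Y d 0) (\<eta> n))
                 (sign_loss (est_on_part n (q n) (\<eta>hat n) Y d 1) (\<eta> n)))
        > real n powr (- (\<delta> / 32)))) \<longlonglongrightarrow> 0"
    by (rule lim[of 2 "{0, 1}"]) (auto simp: less_max_iff_disj)
  show "(\<lambda>n. worst_case_prob 3 n (p n) (q n) (\<theta> n) (\<eta> n) (\<lambda>X Y d.
        max (sign_loss (est_on_part n (p n) (\<theta>hat n) X d 0) (\<theta> n))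
            (sign_loss (est_on_part n (q n) (\<eta>hat n) Y d 0) (\<eta> n))
        > real n powr (- (\<delta> / 32)))) \<longlonglongrightarrow> 0"
    by (rule lim[of 3 "{0}"]) (auto simp: less_max_iff_disj)
qed

end
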